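(* Assume $\mathcal H_\delta(U,V)$ (defined in the context) is satisfied for some $\delta\in(0,1]$, and let $(\varphi,\psi)=(e^{\delta(U-U_\star)},e^{\delta(V-V_\star)})$ with $U_\star=\inf U$, $V_\star=\inf V$. Then for any $n\ge1$ $$\mathrm{Ent}(\mathbb P|P_{2n})=\sum_{p\ge n}\mathrm{Ent}(\lambda_U|\pi_{2p+1})+\sum_{p\ge n}\mathrm{Ent}(\nu_V|\pi_{2p}).$$ In addition, there exist $\rho\in[0,1)$ and $c>0$ such that for any $n\ge1$ $$\mathrm{Ent}(\mathbb P|P_{2n})\le c\,\rho^{2n}\,(\lambda_U(\varphi)+\nu_V(\psi)).$$
   Context: Setting. $(\mathbb X,\lambda)$ and $(\mathbb Y,\nu)$ are locally compact Polish spaces with positive measures $\lambda,\nu$ that are finite on compact sets. $U:\mathbb X\to\mathbb R$, $V:\mathbb Y\to\mathbb R$, $W:\mathbb X\times\mathbb Y\to\mathbb R$ are measurable, such that $\lambda_U(dx):=e^{-U(x)}\lambda(dx)$ and $\nu_V(dy):=e^{-V(y)}\nu(dy)$ are probability measures and $Q(x,dy):=e^{-W(x,y)}\nu(dy)$ is a Markov kernel; more generally $\lambda_F(dx)=e^{-F(x)}\lambda(dx)$, $\nu_G(dy)=e^{-G(y)}\nu(dy)$. Put $R(y,dx):=e^{-W(x,y)}\lambda(dx)$. Integrated costs: $W_U(y)=\int\lambda_U(dx)W(x,y)$, $W^V(x)=\int\nu_V(dy)W(x,y)$. For a kernel $K$, $K(f)(x)=\int K(x,dy)f(y)$ and $(\mu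 K)(dy)=\int\mu(dx)K(x,dy)$; $\mu(f)=\int f\,d\mu$. Relative entropy: $\mathrm{Ent}(\mu_1|\mu_2)=\int\log(d\mu_1/d\mu_2)\,d\mu_1$ ($=+\infty$ if $\mu_1\not\ll\mu_2$). $P_0(d(x,y))=\lambda_U(dx)Q(x,dy)$; $\Pi_{U,V}$ is the set of probability measures on $\mathbb X\times\mathbb Y$ with marginals $\lambda_U,\nu_V$; standing assumption: some $P\in\Pi_{U,V}$ has $\mathrm{Ent}(P|P_0)<\infty$. The Schrödinger bridge is $\mathbb P=\mathrm{argmin}_{P\in\Pi_{U,V}}\mathrm{Ent}(P|P_0)$. Standing regularity: $U,V,W$ are locally bounded (bounded on compact sets), $e^{-W}\in L_\infty(\lambda\otimes\nu)$, and $U,V$ have compact sub-level sets. Condition $\mathcal H_\delta(U,V)$: the functions $\mathcal U_\delta=\delta U-W^V$ and $\mathcal V_\delta=\delta V-W_U$ are locally bounded with compact sub-level sets, and $\lambda_{(1-\delta)U}(e^{W^V})\vee\nu_{(1-\delta)V}(e^{W_U})<\infty$. Sinkhorn iterations. $U_0=U$, $V_0=0$, and for $n\ge0$: $U_{2n+1}=U_{2n}=U+\log Q(e^{-V_{2n}})$, $V_{2(n+1)}=V_{2n+1}=V+\log R(e^{-U_{2n}})$; $$S_{2n}(x,dy)=\frac{Q(x,dy)e^{-V_{2n}(y)}}{Q(e^{-V_{2n}})(x)},\qquad S_{2n+1}(y,dx)=\frac{R(y,dx)e^{-U_{2n+1}(x)}}{R(e^{-U_{2n+1}})(y)};$$ $\pi_{2n}=\lambda_US_{2n}$,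 $\pi_{2n+1}=\nu_VS_{2n+1}$, $P_{2n}(d(x,y))=\lambda_U(dx)S_{2n}(x,dy)$. *)

theory Defs
  imports "HOL-Probability.Probability"
begin

definition locally_bounded :: "('a::topological_space \<Rightarrow> real) \<Rightarrow> bool" where
  "locally_bounded f \<longleftrightarrow> (\<forall>K. compact K \<longrightarrow> bounded (f ` K))"

definition compact_sublevels :: "('a::topological_space \<Rightarrow> real) \<Rightarrow> bool" where
  "compact_sublevels f \<longleftrightarrow> (\<forall>c. compact {x. f x \<le> c})"

text \<open>The relative entropy of the probability measure \<open>\<mu>1\<close> with respect to the probability
  measure \<open>\<mu>2\<close> (note the reversed argument order of the library's \<open>KL_divergence\<close>).
  For probability measures the negative part of the logarithm of the Radon-Nikodym derivative is
  always \<open>\<mu>1\<close>-integrable, so non-integrability means that the integral is \<open>\<infinity>\<close>.\<close>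

definition Ent :: "'a measure \<Rightarrow> 'a measure \<Rightarrow> ereal" where
  "Ent \<mu>1 \<mu>2 =
     (if absolutely_continuous \<mu>2 \<mu>1 \<and> integrable \<mu>1 (entropy_density (exp 1) \<mu>2 \<mu>1)
      then ereal (KL_divergence (exp 1) \<mu>2 \<mu>1) else \<infinity>)"

text \<open>\<open>gibbs \<mu> F\<close> is \<open>\<mu>\<^sub>F(dx) = exp (- F(x)) \<mu>(dx)\<close>.\<close>

definition gibbs :: "'a measure \<Rightarrow> ('a \<Rightarrow> real) \<Rightarrow> 'a measure" where
  "gibbs \<mu> F = density \<mu> (\<lambda>x. ennreal (exp (- F x)))"

definition kernel_Q :: "'b measure \<Rightarrow> ('a \<times> 'b \<Rightarrow> real) \<Rightarrow> 'a \<Rightarrow> 'b measure" where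
  "kernel_Q nu W x = gibbs nu (\<lambda>y. W (x, y))"

definition kernel_R :: "'a measure \<Rightarrow> ('a \<times> 'b \<Rightarrow> real) \<Rightarrow> 'b \<Rightarrow> 'a measure" where
  "kernel_R lam W y = gibbs lam (\<lambda>x. W (x, y))"

text \<open>The integrated costs \<open>W\<^sub>U\<close> and \<open>W\<^sup>V\<close>.\<close>

definition cost_U :: "'a measure \<Rightarrow> ('a \<Rightarrow> real) \<Rightarrow> ('a \<times> 'b \<Rightarrow> real) \<Rightarrow> 'b \<Rightarrow> real" where
  "cost_U lam U W y = (\<integral>x. W (x, y) \<partial>gibbs lam U)"

definition cost_V :: "'b measure \<Rightarrow> ('b \<Rightarrow> real) \<Rightarrow> ('a \<times> 'b \<Rightarrow> real) \<Rightarrow> 'a \<Rightarrow> real" where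
  "cost_V nu V W x = (\<integral>y. W (x, y) \<partial>gibbs nu V)"

definition kernel_apply :: "('a \<Rightarrow> 'b measure) \<Rightarrow> ('b \<Rightarrow> real) \<Rightarrow> 'a \<Rightarrow> real" where
  "kernel_apply K f x = (\<integral>y. f y \<partial>K x)"

text \<open>The measure \<open>\<mu>(dx) K(x, dy)\<close> on the product space. The action \<open>\<mu> K\<close> is the library's
  monadic bind \<open>\<mu> \<bind> K\<close>.\<close>

definition joint ::
  "'a::topological_space measure \<Rightarrow> ('a \<Rightarrow> 'b::topological_space measure) \<Rightarrow> ('a \<times> 'b) measure" where
  "joint \<mu> K = \<mu> \<bind> (\<lambda>x. distr (K x) (borel \<Otimes>\<^sub>M borel) (Pair x))"

text \<open>The coupling set \<open>\<Pi>\<^sub>U\<^sub>,\<^sub>V\<close>.\<close>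

definition couplings ::
  "'a::topological_space measure \<Rightarrow> 'b::topological_space measure \<Rightarrow> ('a \<times> 'b) measure set" where
  "couplings \<mu> \<eta> = {P. prob_space P \<and> sets P = sets (borel \<Otimes>\<^sub>M borel) \<and>
     distr P borel fst = \<mu> \<and> distr P borel snd = \<eta>}"

text \<open>The minimiser is unique when some coupling has finite entropy, because \<open>Ent\<close> is strictly
  convex where it is finite.\<close>

definition schroedinger_bridge ::
  "'a::topological_space measure \<Rightarrow> 'b::topological_space measure \<Rightarrow> ('a \<times> 'b) measure \<Rightarrow> ('a \<times> 'b) measure" where
  "schroedinger_bridge \<mu> \<eta> P0 = arg_min (\<lambda>P. Ent P P0) (\<lambda>P. P \<in> couplings \<mu> \<eta>)"

text \<open>The condition \<open>H\<^sub>\<delta>(U,V)\<close>. That the two functions \<open>\<delta> U - W\<^sup>V\<close> and \<open>\<delta> V - W\<^sub>U\<close> are real-valued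
  is expressed by the two integrability clauses, since the Bochner integral of a
  non-integrable function is 0.\<close>

definition H_cond ::
  "'a::topological_space measure \<Rightarrow> 'b::topological_space measure \<Rightarrow> ('a \<times> 'b \<Rightarrow> real) \<Rightarrow> real \<Rightarrow>
   ('a \<Rightarrow> real) \<Rightarrow> ('b \<Rightarrow> real) \<Rightarrow> bool" where
  "H_cond lam nu W \<delta> U V \<longleftrightarrow>
     (\<forall>x. integrable (gibbs nu V) (\<lambda>y. W (x, y))) \<and>
     (\<forall>y. integrable (gibbs lam U) (\<lambda>x. W (x, y))) \<and>
     locally_bounded (\<lambda>x. \<delta> * U x - cost_V nu V W x) \<and>
     compact_sublevels (\<lambda>x. \<delta> * U x - cost_V nu V W x) \<and>
     locally_bounded (\<lambda>y. \<delta> * V y - cost_U lam U W y) \<and>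
     compact_sublevels (\<lambda>y. \<delta> * V y - cost_U lam U W y) \<and>
     max (\<integral>\<^sup>+x. ennreal (exp (cost_V nu V W x)) \<partial>gibbs lam (\<lambda>x. (1 - \<delta>) * U x))
         (\<integral>\<^sup>+y. ennreal (exp (cost_U lam U W y)) \<partial>gibbs nu (\<lambda>y. (1 - \<delta>) * V y)) < \<infinity>"

text \<open>The Sinkhorn potentials \<open>U\<^sub>n\<close>, \<open>V\<^sub>n\<close>. At an odd-to-even step \<open>V\<^sub>n\<^sub>+\<^sub>1 = V\<^sub>n\<close>, so using \<open>V\<^sub>n\<close> in
  the update of \<open>U\<close> gives \<open>U\<^sub>2\<^sub>n = U + log Q(exp (- V\<^sub>2\<^sub>n))\<close>; see the lemmas below.
  The integrals \<open>Q(exp (- V\<^sub>2\<^sub>n))\<close> and \<open>R(exp (- U\<^sub>2\<^sub>n))\<close> are positive and finite almost everywhere with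
  respect to \<open>lam\<close> and \<open>nu\<close> respectively; values on the exceptional null sets do not affect any
  of the measures built from the potentials.\<close>

fun sinkhorn_U ::
    "'a measure \<Rightarrow> 'b measure \<Rightarrow> ('a \<Rightarrow> real) \<Rightarrow> ('b \<Rightarrow> real) \<Rightarrow> ('a \<times> 'b \<Rightarrow> real) \<Rightarrow> nat \<Rightarrow> 'a \<Rightarrow> real"
  and sinkhorn_V ::
    "'a measure \<Rightarrow> 'b measure \<Rightarrow> ('a \<Rightarrow> real) \<Rightarrow> ('b \<Rightarrow> real) \<Rightarrow> ('a \<times> 'b \<Rightarrow> real) \<Rightarrow> nat \<Rightarrow> 'b \<Rightarrow> real"
where
  "sinkhorn_U lam nu U V W 0 = U"
| "sinkhorn_U lam nu U V W (Suc n) =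
     (if even n then sinkhorn_U lam nu U V W n
      else (\<lambda>x. U x + ln (kernel_apply (kernel_Q nu W) (\<lambda>y. exp (- sinkhorn_V lam nu U V W n y)) x)))"
| "sinkhorn_V lam nu U V W 0 = (\<lambda>y. 0)"
| "sinkhorn_V lam nu U V W (Suc n) =
     (if odd n then sinkhorn_V lam nu U V W n
      else (\<lambda>y. V y + ln (kernel_apply (kernel_R lam W) (\<lambda>x. exp (- sinkhorn_U lam nu U V W n x)) y)))"

lemma sinkhorn_V_even:
  "sinkhorn_V lam nu U V W (2 * (n + 1)) = sinkhorn_V lam nu U V W (2 * n + 1)"
  "sinkhorn_V lam nu U V W (2 * n + 1) =
     (\<lambda>y. V y + ln (kernel_apply (kernel_R lam W) (\<lambda>x. exp (- sinkhorn_U lam nu U V W (2 * n) x)) y))"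
  by simp_all

lemma sinkhorn_U_odd: "sinkhorn_U lam nu U V W (2 * n + 1) = sinkhorn_U lam nu U V W (2 * n)"
  by simp

lemma sinkhorn_U_even:
  assumes "\<And>x. prob_space (kernel_Q nu W x)"
  shows "sinkhorn_U lam nu U V W (2 * n) =
     (\<lambda>x. U x + ln (kernel_apply (kernel_Q nu W) (\<lambda>y. exp (- sinkhorn_V lam nu U V W (2 * n) y)) x))"
proof (cases n)
  case 0
  have "kernel_apply (kernel_Q nu W) (\<lambda>y. 1) x = 1" for x
    using prob_space.prob_space[OF assms] by (simp add: kernel_apply_def)
  then show ?thesis using 0 by simp
qed simp

text \<open>The Markov kernel \<open>K(x, dy) f(y) / K(f)(x)\<close>.\<close>

definition normalized_kernel :: "('a \<Rightarrow> 'b measure) \<Rightarrow> ('b \<Rightarrow> real) \<Rightarrow> 'a \<Rightarrow> 'b measure" where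
  "normalized_kernel K f x = density (K x) (\<lambda>y. ennreal (f y / kernel_apply K f x))"

text \<open>\<open>sinkhorn_S_even \<dots> n\<close> is \<open>S\<^sub>2\<^sub>n\<close> and \<open>sinkhorn_S_odd \<dots> n\<close> is \<open>S\<^sub>2\<^sub>n\<^sub>+\<^sub>1\<close>; likewise for
  \<open>\<pi>\<^sub>2\<^sub>n\<close>, \<open>\<pi>\<^sub>2\<^sub>n\<^sub>+\<^sub>1\<close> and \<open>P\<^sub>2\<^sub>n\<close>.\<close>

definition sinkhorn_S_even ::
    "'a measure \<Rightarrow> 'b measure \<Rightarrow> ('a \<Rightarrow> real) \<Rightarrow> ('b \<Rightarrow> real) \<Rightarrow> ('a \<times> 'b \<Rightarrow> real) \<Rightarrow> nat \<Rightarrow> 'a \<Rightarrow> 'b measure"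
where
  "sinkhorn_S_even lam nu U V W n =
     normalized_kernel (kernel_Q nu W) (\<lambda>y. exp (- sinkhorn_V lam nu U V W (2 * n) y))"

definition sinkhorn_S_odd ::
    "'a measure \<Rightarrow> 'b measure \<Rightarrow> ('a \<Rightarrow> real) \<Rightarrow> ('b \<Rightarrow> real) \<Rightarrow> ('a \<times> 'b \<Rightarrow> real) \<Rightarrow> nat \<Rightarrow> 'b \<Rightarrow> 'a measure"
where
  "sinkhorn_S_odd lam nu U V W n =
     normalized_kernel (kernel_R lam W) (\<lambda>x. exp (- sinkhorn_U lam nu U V W (2 * n + 1) x))"

definition sinkhorn_pi_even ::
    "'a measure \<Rightarrow> 'b measure \<Rightarrow> ('a \<Rightarrow> real) \<Rightarrow> ('b \<Rightarrow> real) \<Rightarrow> ('a \<times> 'b \<Rightarrow> real) \<Rightarrow> nat \<Rightarrow> 'b measure"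
where
  "sinkhorn_pi_even lam nu U V W n = gibbs lam U \<bind> sinkhorn_S_even lam nu U V W n"

definition sinkhorn_pi_odd ::
    "'a measure \<Rightarrow> 'b measure \<Rightarrow> ('a \<Rightarrow> real) \<Rightarrow> ('b \<Rightarrow> real) \<Rightarrow> ('a \<times> 'b \<Rightarrow> real) \<Rightarrow> nat \<Rightarrow> 'a measure"
where
  "sinkhorn_pi_odd lam nu U V W n = gibbs nu V \<bind> sinkhorn_S_odd lam nu U V W n"

definition sinkhorn_P_even ::
    "'a::topological_space measure \<Rightarrow> 'b::topological_space measure \<Rightarrow> ('a \<Rightarrow> real) \<Rightarrow> ('b \<Rightarrow> real) \<Rightarrow>
     ('a \<times> 'b \<Rightarrow> real) \<Rightarrow> nat \<Rightarrow> ('a \<times> 'b) measure"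
where
  "sinkhorn_P_even lam nu U V W n = joint (gibbs lam U) (sinkhorn_S_even lam nu U V W n)"

end

theory Submission
  imports Defs
begin

text \<open>
  Take the marginals \<open>\<mu> = \<lambda>\<^sub>U\<close> and \<open>\<eta> = \<nu>\<^sub>V\<close> as reference measures and put \<open>f\<^sub>n = U\<^sub>2\<^sub>n - U\<close>,
  \<open>g\<^sub>n = V\<^sub>2\<^sub>n - V\<close>. Then \<open>P\<^sub>2\<^sub>n\<close> has the density \<open>exp (- W - f\<^sub>n - g\<^sub>n)\<close> with respect to \<open>\<mu> \<otimes> \<eta>\<close>, while
  \<open>\<pi>\<^sub>2\<^sub>n\<close> has the density \<open>exp (g\<^sub>n\<^sub>+\<^sub>1 - g\<^sub>n)\<close> with respect to \<open>\<eta>\<close> and \<open>\<pi>\<^sub>2\<^sub>n\<^sub>+\<^sub>1\<close> has the density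
  \<open>exp (f\<^sub>n\<^sub>+\<^sub>1 - f\<^sub>n)\<close> with respect to \<open>\<mu>\<close>. The entropies \<open>Ent(\<nu>\<^sub>V|\<pi>\<^sub>2\<^sub>n)\<close> and \<open>Ent(\<lambda>\<^sub>U|\<pi>\<^sub>2\<^sub>n\<^sub>+\<^sub>1)\<close> are thus
  the decrements of the means \<open>\<eta>(g\<^sub>n)\<close> and \<open>\<mu>(f\<^sub>n)\<close>.

  These means decrease, and together with Jensen's inequality and \<open>exp (- W) \<le> C\<close> this bounds the potentials
  uniformly: \<open>- W\<^sup>V - c \<le> f\<^sub>n \<le> c\<close> and \<open>- W\<^sub>U - c \<le> g\<^sub>n \<le> c\<close> for \<open>n \<ge> 1\<close>. Hence the transition kernels
  \<open>exp (- W - f - g)\<close> satisfy, uniformly in \<open>n\<close>, a drift condition for the Lyapunov functions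
  \<open>exp (\<delta> U)\<close>, \<open>exp (\<delta> V)\<close> (\<open>kernel_drift\<close>; by assumption \<open>exp W\<^sup>V\<close> and \<open>exp W\<^sub>U\<close> grow more slowly than
  these) and a minorization on their compact sublevel sets, where \<open>W\<close> is bounded. By a Harris type
  argument (\<open>drift_minorization_contraction\<close>) they contract a weighted total variation norm on densities of
  mass zero. The kernels map the marginal error \<open>\<pi>\<^sub>2\<^sub>n - \<nu>\<^sub>V\<close> to \<open>\<lambda>\<^sub>U - \<pi>\<^sub>2\<^sub>n\<^sub>+\<^sub>1\<close>, and \<open>\<pi>\<^sub>2\<^sub>n\<^sub>+\<^sub>1 - \<lambda>\<^sub>U\<close> to
  \<open>\<nu>\<^sub>V - \<pi>\<^sub>2\<^sub>n\<^sub>+\<^sub>2\<close>, so that these errors decay geometrically (\<open>geometric_contraction\<close>).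

  The logarithms of the densities are bounded by the weights, and so the \<open>L\<^sup>1\<close> distance of consecutive
  potentials is controlled by the weighted norm (\<open>L1_le_weighted\<close>) and decays geometrically as well. The
  potentials converge, and their limits solve the Schroedinger system (\<open>potentials_converge\<close>). The plan
  built from the limits is a coupling. Since the entropies of a coupling relative to two plans of the form
  \<open>exp (- W - f - g)\<close> differ by a constant (\<open>Ent_plan\<close>), every minimiser has entropy 0 relative to the limit
  plan, and its entropy relative to \<open>P\<^sub>2\<^sub>n\<close> is \<open>\<mu>(f\<^sub>n - f\<^sub>\<infinity>) + \<eta>(g\<^sub>n - g\<^sub>\<infinity>)\<close>. Telescoping yields the
  series, and the rate for the potentials yields the rate for the entropy (\<open>sinkhorn_entropy\<close>).
\<close>

section \<open>Relative entropy under a change of reference measure\<close>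

text \<open>The logarithm of the density is additive in the reference measure, so tilting the reference by
  \<open>exp h\<close> shifts the entropy by a constant. The identity also covers infinite entropies, because the
  positive tilt leaves absolute continuity unchanged and the integrable \<open>h\<close> leaves integrability
  unchanged. The entropies of marginals and of couplings are computed from this
  lemma.\<close>

lemma Ent_density_exp:
  fixes h :: "'a \<Rightarrow> real"
  assumes M: "prob_space M" and P: "prob_space P" and sets: "sets P = sets M"
    and h[measurable]: "h \<in> borel_measurable M" and hint: "integrable P h"
  shows "Ent P (density M (\<lambda>x. ennreal (exp (h x)))) = Ent P M - ereal (\<integral>x. h x \<partial>P)"
proof -
  interpret M: prob_space M by fact
  interpret P: prob_space P by fact
  let ?D = "density M (\<lambda>x. ennreal (exp (h x)))"
  have null: "null_sets ?D = null_sets M"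
  proof (intro set_eqI)
    fix A show "A \<in> null_sets ?D \<longleftrightarrow> A \<in> null_sets M"
    proof (cases "A \<in> sets M")
      case True
      then show ?thesis by (subst null_sets_density_iff) (simp_all add: AE_iff_null_sets)
    qed (auto dest: null_setsD2)
  qed
  then have ac_iff: "absolutely_continuous ?D P \<longleftrightarrow> absolutely_continuous M P"
    by (simp add: absolutely_continuous_def)
  show ?thesis
  proof (cases "absolutely_continuous M P")
    case False
    then show ?thesis by (simp add: Ent_def ac_iff)
  next
    case True
    define r where "r = RN_deriv M P"
    have r[measurable]: "r \<in> borel_measurable M" by (simp add: r_def)
    have r_dens: "density M r = P"
      unfolding r_def by (rule M.density_RN_deriv[OF True sets])
    have "density ?D (\<lambda>x. r x * ennreal (exp (- h x))) = density M r"
      by (subst density_density_eq)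
         (auto intro!: density_cong simp: mult.commute[of "ennreal _" "_ * _"] mult.assoc
            ennreal_mult[symmetric] exp_minus)
    then have eq: "density ?D (\<lambda>x. r x * ennreal (exp (- h x))) = P" using r_dens by simp
    have "AE x in ?D. r x * ennreal (exp (- h x)) = RN_deriv ?D P x"
      by (rule RN_deriv_unique_sigma_finite[OF _ eq P.sigma_finite_measure_axioms]) simp
    then have "AE x in M. r x * ennreal (exp (- h x)) = RN_deriv ?D P x"
      by (subst (asm) AE_density) auto
    then have ae1: "AE x in P. r x * ennreal (exp (- h x)) = RN_deriv ?D P x"
      using True by (subst r_dens[symmetric], subst AE_density) auto
    have ae2: "AE x in P. 0 < r x"
      by (subst r_dens[symmetric], subst AE_density) auto
    have "AE x in M. r x \<noteq> \<infinity>"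
      unfolding r_def by (rule M.RN_deriv_finite[OF P.sigma_finite_measure_axioms True sets])
    then have ae3: "AE x in P. r x \<noteq> \<infinity>"
      by (subst r_dens[symmetric], subst AE_density) auto
    have ae: "AE x in P. entropy_density (exp 1) ?D P x = entropy_density (exp 1) M P x - h x"
      using ae1 ae2 ae3
    proof eventually_elim
      case (elim x)
      then obtain q where q: "r x = ennreal q" "q > 0"
        by (metis ennreal_cases ennreal_less_zero_iff infinity_ennreal_def)
      then have "enn2real (RN_deriv ?D P x) = q * exp (- h x)"
        using elim(1) by (metis enn2real_ennreal ennreal_mult'' exp_ge_zero mult_nonneg_nonneg less_imp_le)
      moreover have "enn2real (RN_deriv M P x) = q" using q by (simp add: r_def)
      ultimately show ?case using q
        by (simp add: entropy_density_def log_def ln_mult)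
    qed
    have m1: "entropy_density (exp 1) M P \<in> borel_measurable P"
      and m2: "entropy_density (exp 1) ?D P \<in> borel_measurable P"
      using measurable_entropy_density[of "exp 1" M P]
            measurable_entropy_density[of "exp 1" ?D P]
      by (auto simp: measurable_cong_sets[OF sets refl] entropy_density_def)
    have int_iff: "integrable P (entropy_density (exp 1) ?D P) \<longleftrightarrow> integrable P (entropy_density (exp 1) M P)"
    proof -
      have "integrable P (entropy_density (exp 1) ?D P)
         \<longleftrightarrow> integrable P (\<lambda>x. entropy_density (exp 1) M P x - h x)"
        using m1 m2 ae borel_measurable_integrable[OF hint]
        by (intro integrable_cong_AE borel_measurable_diff)
      also have "\<dots> \<longleftrightarrow> integrable P (entropy_density (exp 1) M P)"
      proof
        assume "integrable P (\<lambda>x. entropy_density (exp 1) M P x - h x)"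
        from Bochner_Integration.integrable_add[OF this hint]
        show "integrable P (entropy_density (exp 1) M P)" by simp
      qed (use hint in auto)
      finally show ?thesis .
    qed
    have "KL_divergence (exp 1) ?D P = KL_divergence (exp 1) M P - (\<integral>x. h x \<partial>P)"
      if "integrable P (entropy_density (exp 1) M P)"
    proof -
      have "KL_divergence (exp 1) ?D P = (\<integral>x. entropy_density (exp 1) M P x - h x \<partial>P)"
        unfolding KL_divergence_def using m1 m2 ae borel_measurable_integrable[OF hint]
        by (intro integral_cong_AE borel_measurable_diff)
      then show ?thesis using that hint by (simp add: KL_divergence_def)
    qed
    then show ?thesis by (simp add: Ent_def ac_iff True int_iff)
  qed
qed

lemma Ent_nonneg:
  assumes M: "prob_space M" and P: "prob_space P" and sets: "sets P = sets M"
  shows "0 \<le> Ent P M"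
proof (cases "absolutely_continuous M P \<and> integrable P (entropy_density (exp 1) M P)")
  case True
  interpret M: information_space M "exp 1"
    using M by (simp add: information_space_def information_space_axioms_def)
  interpret P: prob_space P by fact
  define D where "D x = enn2real (RN_deriv M P x)" for x
  have [measurable]: "D \<in> borel_measurable M" by (simp add: D_def[abs_def])
  have "AE x in M. RN_deriv M P x \<noteq> \<infinity>"
    using True by (intro M.RN_deriv_finite P.sigma_finite_measure_axioms sets) auto
  then have "density M (\<lambda>x. ennreal (D x)) = density M (RN_deriv M P)"
    by (intro density_cong) (auto simp: D_def less_top)
  then have eq: "density M (\<lambda>x. ennreal (D x)) = P"
    using M.density_RN_deriv[of P] True sets by simp
  have "integrable (density M (\<lambda>x. ennreal (D x))) (\<lambda>x. log (exp 1) (D x))"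
    using True unfolding eq by (simp add: entropy_density_def D_def comp_def)
  then have "integrable M (\<lambda>x. D x * log (exp 1) (D x))"
    by (subst (asm) integrable_density) (auto simp: D_def)
  then have "0 \<le> KL_divergence (exp 1) M (density M D)"
    using P by (intro M.KL_nonneg) (simp_all add: eq, simp add: D_def)
  then show ?thesis using True by (simp add: Ent_def eq)
qed (auto simp: Ent_def)

lemma Ent_self:
  assumes "prob_space M" shows "Ent M M = 0"
proof -
  interpret prob_space M by fact
  have "AE x in M. 1 = RN_deriv M M x"
    by (rule RN_deriv_unique) (auto simp: density_1)
  then have ae: "AE x in M. entropy_density (exp 1) M M x = 0"
    by eventually_elim (simp add: entropy_density_def)
  have "integrable M (entropy_density (exp 1) M M)"
    using ae by (subst integrable_cong_AE[of _ _ "\<lambda>_. 0"]) (auto intro!: measurable_entropy_density)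
  then show ?thesis by (simp add: Ent_def KL_same_eq_0 absolutely_continuous_def zero_ereal_def)
qed

lemma Ent_density_exp_self:
  fixes h :: "'a \<Rightarrow> real"
  assumes M: "prob_space M" and h[measurable]: "h \<in> borel_measurable M" and hint: "integrable M h"
  shows "Ent M (density M (\<lambda>x. ennreal (exp (h x)))) = ereal (- (\<integral>x. h x \<partial>M))"
  by (simp add: Ent_density_exp[OF M M refl h hint] Ent_self[OF M])

section \<open>Contraction from drift and minorization\<close>

text \<open>A one-step form of the Hairer--Mattingly version of Harris' theorem, for signed densities \<open>u\<close> of mass
  zero. On the rows \<open>x\<close> with \<open>\<phi> x \<le> R\<close> the kernel dominates the function \<open>\<beta>\<close> on \<open>{\<psi> \<le> R}\<close>; subtracting
  that function from every row does not change the image of \<open>u\<close>, since \<open>u\<close> has mass zero. The rows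
  with \<open>\<phi> x \<le> R\<close> lose mass. The others gain at most \<open>\<beta> (1 + b R)\<close>, where \<open>b = \<beta> / (4 K)\<close>, which the
  drift, with its factor \<open>1 / 2\<close>, absorbs because \<open>\<phi> x\<close> is large there. The choice of \<open>b\<close> and the
  bound \<open>48 * K \<le> R\<close> balance the two cases, so that both give the factor \<open>1 - \<beta> / 4\<close>.\<close>

lemma drift_minorization_contraction:
  fixes s :: "'a \<Rightarrow> 'b \<Rightarrow> real"
  assumes "prob_space A" "prob_space B"
    and s[measurable]: "(\<lambda>(x, y). s x y) \<in> borel_measurable (A \<Otimes>\<^sub>M B)" and s0: "\<And>x y. 0 \<le> s x y"
    and \<phi>[measurable]: "\<phi> \<in> borel_measurable A" and \<phi>0: "\<And>x. 0 \<le> \<phi> x"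
    and \<psi>[measurable]: "\<psi> \<in> borel_measurable B" and \<psi>0: "\<And>y. 0 \<le> \<psi> y"
    and mass: "AE x in A. (\<integral>\<^sup>+y. ennreal (s x y) \<partial>B) = 1"
    and drift: "AE x in A. (\<integral>\<^sup>+y. ennreal (s x y * \<psi> y) \<partial>B) \<le> ennreal (\<phi> x / 2 + K)"
    and minor: "AE x in A. AE y in B. \<phi> x \<le> R \<longrightarrow> \<psi> y \<le> R \<longrightarrow> \<beta> \<le> s x y"
    and K: "0 < K" and R: "48 * K \<le> R" and \<beta>: "0 < \<beta>" "\<beta> \<le> 1 / 8"
    and half: "1 / 2 \<le> measure B {y \<in> space B. \<psi> y \<le> R}"
    and u: "integrable A u" "(\<integral>x. u x \<partial>A) = 0"
    and v[measurable]: "v \<in> borel_measurable B"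
    and vu: "AE y in B. integrable A (\<lambda>x. s x y * u x) \<and> v y = (\<integral>x. s x y * u x \<partial>A)"
  shows "(\<integral>\<^sup>+y. ennreal (\<bar>v y\<bar> * (1 + \<beta> / (4 * K) * \<psi> y)) \<partial>B)
    \<le> ennreal (1 - \<beta> / 4) * (\<integral>\<^sup>+x. ennreal (\<bar>u x\<bar> * (1 + \<beta> / (4 * K) * \<phi> x)) \<partial>A)"
proof -
  interpret A: prob_space A by fact
  interpret B: prob_space B by fact
  interpret AB: pair_sigma_finite A B ..
  define b where "b = \<beta> / (4 * K)"
  have b: "0 < b" "b * K = \<beta> / 4" using K \<beta> by (auto simp: b_def field_simps)
  define i :: "'b \<Rightarrow> real" where "i y = (if \<psi> y \<le> R then 1 else 0)" for y
  have i[measurable]: "i \<in> borel_measurable B" unfolding i_def by measurable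
  have um[measurable]: "u \<in> borel_measurable A" using u(1) by simp
  have R0: "0 < R" using R K by simp
  have int_i: "integrable B i" by (rule B.integrable_const_bound[of _ 1]) (auto simp: i_def)
  have int_i_ge: "1 / 2 \<le> (\<integral>y. i y \<partial>B)"
  proof -
    have "(\<integral>y. i y \<partial>B) = (\<integral>y. indicator {y \<in> space B. \<psi> y \<le> R} y \<partial>B)"
      by (intro Bochner_Integration.integral_cong) (auto simp: i_def)
    then show ?thesis using half by simp
  qed
  have int_i_le: "(\<integral>y. i y \<partial>B) \<le> 1"
    using B.integral_le_const[OF int_i, of 1] by (auto simp: i_def)
  \<comment> \<open>The constant multiple \<open>\<beta> * i y\<close> of \<open>u\<close> has integral 0 and may be subtracted under the integral.\<close>
  have pointwise: "ennreal \<bar>v y\<bar> \<le> (\<integral>\<^sup>+x. ennreal (\<bar>s x y - \<beta> * i y\<bar> * \<bar>u x\<bar>) \<partial>A)"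
    if "integrable A (\<lambda>x. s x y * u x)" "v y = (\<integral>x. s x y * u x \<partial>A)" for y
  proof -
    have "integrable A (\<lambda>x. s x y * u x - (\<beta> * i y) * u x)" using that u by auto
    then have int: "integrable A (\<lambda>x. (s x y - \<beta> * i y) * u x)" by (simp add: algebra_simps)
    have "v y = (\<integral>x. s x y * u x - (\<beta> * i y) * u x \<partial>A)"
      using that u by simp
    also have "\<dots> = (\<integral>x. (s x y - \<beta> * i y) * u x \<partial>A)" by (simp add: algebra_simps)
    finally have "\<bar>v y\<bar> \<le> (\<integral>x. \<bar>(s x y - \<beta> * i y) * u x\<bar> \<partial>A)"
      by (simp add: integral_abs_bound)
    then have "ennreal \<bar>v y\<bar> \<le> ennreal (\<integral>x. \<bar>(s x y - \<beta> * i y) * u x\<bar> \<partial>A)"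
      by (rule ennreal_leI)
    also have "\<dots> = (\<integral>\<^sup>+x. ennreal \<bar>(s x y - \<beta> * i y) * u x\<bar> \<partial>A)"
      using int by (subst nn_integral_eq_integral) auto
    finally show ?thesis by (simp add: abs_mult)
  qed
  have column: "(\<integral>\<^sup>+y. ennreal (\<bar>s x y - \<beta> * i y\<bar> * (1 + b * \<psi> y)) \<partial>B) \<le> ennreal ((1 - \<beta> / 4) * (1 + b * \<phi> x))"
    if x: "x \<in> space A"
      and mass: "(\<integral>\<^sup>+y. ennreal (s x y) \<partial>B) = 1"
      and drift: "(\<integral>\<^sup>+y. ennreal (s x y * \<psi> y) \<partial>B) \<le> ennreal (\<phi> x / 2 + K)"
      and minor: "AE y in B. \<phi> x \<le> R \<longrightarrow> \<psi> y \<le> R \<longrightarrow> \<beta> \<le> s x y" for x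
  proof -
    have [measurable]: "s x \<in> borel_measurable B" using s x by measurable
    have s_int: "integrable B (s x)" "(\<integral>y. s x y \<partial>B) = 1"
      using mass s0 by (auto intro!: integrableI_nonneg simp: integral_eq_nn_integral)
    have s\<psi>_int: "integrable B (\<lambda>y. s x y * \<psi> y)"
      using drift s0 \<psi>0 by (intro integrableI_nonneg) (auto simp: less_top[symmetric] top_unique)
    have s\<psi>_le: "(\<integral>y. s x y * \<psi> y \<partial>B) \<le> \<phi> x / 2 + K"
    proof -
      have "ennreal (\<integral>y. s x y * \<psi> y \<partial>B) \<le> ennreal (\<phi> x / 2 + K)"
        using drift s0 \<psi>0 by (subst nn_integral_eq_integral[symmetric, OF s\<psi>_int]) auto
      then show ?thesis using \<phi>0[of x] K by (subst (asm) ennreal_le_iff) auto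
    qed
    have bphi: "0 \<le> b * \<phi> x" using b \<phi>0 by simp
    show ?thesis
    proof (cases "\<phi> x \<le> R")
      case True
      let ?h = "\<lambda>y. s x y - \<beta> * i y + b * (s x y * \<psi> y)"
      have "AE y in B. \<bar>s x y - \<beta> * i y\<bar> * (1 + b * \<psi> y) \<le> ?h y"
        using minor
      proof eventually_elim
        case (elim y)
        have "\<beta> * i y \<le> s x y" using elim True s0[of x y] by (auto simp: i_def)
        then have "\<bar>s x y - \<beta> * i y\<bar> * (1 + b * \<psi> y) = (s x y - \<beta> * i y) + (s x y - \<beta> * i y) * (b * \<psi> y)"
          by (simp add: algebra_simps)
        also have "(s x y - \<beta> * i y) * (b * \<psi> y) \<le> s x y * (b * \<psi> y)"
          using b \<psi>0[of y] \<beta> by (intro mult_right_mono) (auto simp: i_def)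
        finally show ?case by (simp add: algebra_simps)
      qed
      then have "(\<integral>\<^sup>+y. ennreal (\<bar>s x y - \<beta> * i y\<bar> * (1 + b * \<psi> y)) \<partial>B) \<le> (\<integral>\<^sup>+y. ennreal (?h y) \<partial>B)"
        by (intro nn_integral_mono_AE) (auto intro!: ennreal_leI)
      also have "\<dots> = ennreal (\<integral>y. ?h y \<partial>B)"
      proof (rule nn_integral_eq_integral)
        show "AE y in B. 0 \<le> ?h y" using minor
          by eventually_elim (use True s0 \<psi>0 b in \<open>auto simp: i_def intro!: add_nonneg_nonneg mult_nonneg_nonneg\<close>)
      qed (use s_int s\<psi>_int int_i in auto)
      also have "\<dots> \<le> ennreal ((1 - \<beta> / 4) * (1 + b * \<phi> x))"
      proof (rule ennreal_leI)
        have "(\<integral>y. ?h y \<partial>B) = 1 - \<beta> * (\<integral>y. i y \<partial>B) + b * (\<integral>y. s x y * \<psi> y \<partial>B)"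
          using s_int s\<psi>_int int_i by simp
        also have "\<dots> \<le> 1 - \<beta> * (1 / 2) + b * (\<phi> x / 2 + K)"
          using int_i_ge s\<psi>_le \<beta> b by (intro add_mono diff_mono mult_left_mono) auto
        also have "\<dots> = 1 - \<beta> / 4 + b * \<phi> x / 2"
          using b(2) by (simp add: algebra_simps)
        also have "b * \<phi> x / 2 \<le> (1 - \<beta> / 4) * (b * \<phi> x)"
          using mult_right_mono[OF _ bphi, of "1 / 2" "1 - \<beta> / 4"] \<beta> by simp
        also have "1 - \<beta> / 4 + (1 - \<beta> / 4) * (b * \<phi> x) = (1 - \<beta> / 4) * (1 + b * \<phi> x)"
          by (simp add: algebra_simps)
        finally show "(\<integral>y. ?h y \<partial>B) \<le> (1 - \<beta> / 4) * (1 + b * \<phi> x)" by simp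
      qed
      finally show ?thesis .
    next
      case False
      let ?h = "\<lambda>y. s x y + b * (s x y * \<psi> y) + \<beta> * (1 + b * R) * i y"
      have "\<bar>s x y - \<beta> * i y\<bar> * (1 + b * \<psi> y) \<le> ?h y" for y
      proof -
        have "0 \<le> \<beta> * i y" using \<beta> by (simp add: i_def)
        then have "\<bar>s x y - \<beta> * i y\<bar> \<le> s x y + \<beta> * i y" using s0[of x y] by linarith
        then have "\<bar>s x y - \<beta> * i y\<bar> * (1 + b * \<psi> y) \<le> (s x y + \<beta> * i y) * (1 + b * \<psi> y)"
          using b \<psi>0[of y] by (intro mult_right_mono) auto
        also have "\<dots> = s x y + b * (s x y * \<psi> y) + \<beta> * ((1 + b * \<psi> y) * i y)" by (simp add: algebra_simps)
        also have "\<beta> * ((1 + b * \<psi> y) * i y) \<le> \<beta> * ((1 + b * R) * i y)"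
          using b \<beta> by (intro mult_left_mono) (auto simp: i_def)
        finally show ?thesis by (simp add: algebra_simps)
      qed
      then have "(\<integral>\<^sup>+y. ennreal (\<bar>s x y - \<beta> * i y\<bar> * (1 + b * \<psi> y)) \<partial>B) \<le> (\<integral>\<^sup>+y. ennreal (?h y) \<partial>B)"
        by (intro nn_integral_mono) (auto intro!: ennreal_leI)
      also have "\<dots> = ennreal (\<integral>y. ?h y \<partial>B)"
      proof (rule nn_integral_eq_integral)
        show "AE y in B. 0 \<le> ?h y"
          by (rule AE_I2) (use s0 \<psi>0 b(1) \<beta>(1) R0 in \<open>auto simp: i_def intro!: add_nonneg_nonneg mult_nonneg_nonneg\<close>)
      qed (use s_int s\<psi>_int int_i in auto)
      also have "\<dots> \<le> ennreal ((1 - \<beta> / 4) * (1 + b * \<phi> x))"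
      proof (rule ennreal_leI)
        have "(\<integral>y. ?h y \<partial>B) = 1 + b * (\<integral>y. s x y * \<psi> y \<partial>B) + \<beta> * (1 + b * R) * (\<integral>y. i y \<partial>B)"
          using s_int s\<psi>_int int_i by simp
        also have "\<dots> \<le> 1 + b * (\<phi> x / 2 + K) + \<beta> * (1 + b * R) * 1"
          using int_i_le s\<psi>_le \<beta> b R0 by (intro add_mono mult_left_mono) auto
        also have "\<dots> = 1 + b * \<phi> x / 2 + 5 * (\<beta> / 4) + \<beta> * (b * R)"
          using b(2) by (simp add: algebra_simps)
        also have "\<dots> \<le> (1 - \<beta> / 4) * (1 + b * \<phi> x)"
        proof -
          have bR: "b * R \<le> b * \<phi> x" using False b by simp
          have "12 * \<beta> = b * (48 * K)" using b(2) by (simp add: algebra_simps)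
          also have "\<dots> \<le> b * R" using R b by (intro mult_left_mono) auto
          finally have bR2: "12 * \<beta> \<le> b * R" .
          have "\<beta> * (b * R) \<le> (1 / 8) * (b * \<phi> x)"
            using \<beta> bR bphi b R0 by (intro mult_mono) auto
          moreover have "\<beta> / 4 * (b * \<phi> x) \<le> (1 / 32) * (b * \<phi> x)"
            using \<beta> bphi by (intro mult_right_mono) auto
          moreover have "(1 - \<beta> / 4) * (1 + b * \<phi> x) = 1 - \<beta> / 4 + b * \<phi> x - \<beta> / 4 * (b * \<phi> x)"
            by (simp add: algebra_simps)
          ultimately show ?thesis using bR bR2 \<beta> by linarith
        qed
        finally show "(\<integral>y. ?h y \<partial>B) \<le> (1 - \<beta> / 4) * (1 + b * \<phi> x)" .
      qed
      finally show ?thesis .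
    qed
  qed
  have "(\<integral>\<^sup>+y. ennreal (\<bar>v y\<bar> * (1 + b * \<psi> y)) \<partial>B)
      \<le> (\<integral>\<^sup>+y. (\<integral>\<^sup>+x. ennreal (\<bar>s x y - \<beta> * i y\<bar> * \<bar>u x\<bar>) * ennreal (1 + b * \<psi> y) \<partial>A) \<partial>B)"
    using vu AE_space[of B]
  proof (intro nn_integral_mono_AE, eventually_elim)
    case (elim y)
    have *: "0 \<le> 1 + b * \<psi> y" using b \<psi>0[of y] by simp
    have [measurable]: "(\<lambda>x. s x y) \<in> borel_measurable A" using s elim by measurable
    show ?case
      using mult_right_mono[OF pointwise[of y], of "ennreal (1 + b * \<psi> y)"] elim *
      by (subst nn_integral_multc) (auto simp: ennreal_mult)
  qed
  also have "\<dots> = (\<integral>\<^sup>+x. (\<integral>\<^sup>+y. ennreal (\<bar>s x y - \<beta> * i y\<bar> * \<bar>u x\<bar>) * ennreal (1 + b * \<psi> y) \<partial>B) \<partial>A)"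
    by (rule AB.Fubini') measurable
  also have "\<dots> = (\<integral>\<^sup>+x. ennreal \<bar>u x\<bar> * (\<integral>\<^sup>+y. ennreal (\<bar>s x y - \<beta> * i y\<bar> * (1 + b * \<psi> y)) \<partial>B) \<partial>A)"
  proof (rule nn_integral_cong)
    fix x assume "x \<in> space A"
    then have [measurable]: "s x \<in> borel_measurable B" using s by measurable
    have "ennreal (\<bar>s x y - \<beta> * i y\<bar> * \<bar>u x\<bar>) * ennreal (1 + b * \<psi> y)
        = ennreal \<bar>u x\<bar> * ennreal (\<bar>s x y - \<beta> * i y\<bar> * (1 + b * \<psi> y))" for y
      using b \<psi>0[of y] by (simp add: ennreal_mult ac_simps)
    then show "(\<integral>\<^sup>+y. ennreal (\<bar>s x y - \<beta> * i y\<bar> * \<bar>u x\<bar>) * ennreal (1 + b * \<psi> y) \<partial>B)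
       = ennreal \<bar>u x\<bar> * (\<integral>\<^sup>+y. ennreal (\<bar>s x y - \<beta> * i y\<bar> * (1 + b * \<psi> y)) \<partial>B)"
      by (simp add: nn_integral_cmult)
  qed
  also have "\<dots> \<le> (\<integral>\<^sup>+x. ennreal (1 - \<beta> / 4) * ennreal (\<bar>u x\<bar> * (1 + b * \<phi> x)) \<partial>A)"
    using mass drift minor AE_space[of A]
  proof (intro nn_integral_mono_AE, eventually_elim)
    case (elim x)
    have "ennreal \<bar>u x\<bar> * (\<integral>\<^sup>+y. ennreal (\<bar>s x y - \<beta> * i y\<bar> * (1 + b * \<psi> y)) \<partial>B)
      \<le> ennreal \<bar>u x\<bar> * ennreal ((1 - \<beta> / 4) * (1 + b * \<phi> x))"
      by (intro mult_left_mono column) (use elim in auto)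
    also have "\<dots> = ennreal (1 - \<beta> / 4) * ennreal (\<bar>u x\<bar> * (1 + b * \<phi> x))"
      using b \<phi>0[of x] \<beta> by (simp add: ennreal_mult[symmetric] ac_simps)
    finally show ?case .
  qed
  also have "\<dots> = ennreal (1 - \<beta> / 4) * (\<integral>\<^sup>+x. ennreal (\<bar>u x\<bar> * (1 + b * \<phi> x)) \<partial>A)"
    by (intro nn_integral_cmult) measurable
  finally show ?thesis by (simp add: b_def)
qed

section \<open>Costs with Lyapunov functions\<close>

definition log_partition :: "'b measure \<Rightarrow> ('a \<Rightarrow> 'b \<Rightarrow> real) \<Rightarrow> ('b \<Rightarrow> real) \<Rightarrow> 'a \<Rightarrow> real" where
  "log_partition N w g x = ln (\<integral>y. exp (- w x y - g y) \<partial>N)"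

text \<open>Jensen's inequality for the exponential, by comparing it with its tangent at the mean.\<close>

lemma exp_integral_le_integral_exp:
  fixes h :: "'a \<Rightarrow> real"
  assumes "prob_space M" "integrable M h" "integrable M (\<lambda>x. exp (h x))"
  shows "exp (\<integral>x. h x \<partial>M) \<le> (\<integral>x. exp (h x) \<partial>M)"
proof -
  interpret prob_space M by fact
  let ?m = "\<integral>x. h x \<partial>M"
  have "exp ?m = (\<integral>x. exp ?m * (1 + (h x - ?m)) \<partial>M)"
    using assms by (simp add: prob_space)
  also have "\<dots> \<le> (\<integral>x. exp (h x) \<partial>M)"
  proof (rule integral_mono)
    fix x
    have "exp ?m * (1 + (h x - ?m)) \<le> exp ?m * exp (h x - ?m)"
      by (intro mult_left_mono exp_ge_add_one_self) auto
    then show "exp ?m * (1 + (h x - ?m)) \<le> exp (h x)" by (simp add: exp_diff)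
  qed (use assms in auto)
  finally show ?thesis .
qed

text \<open>With \<open>h\<close> the integrated cost, this is the class that contains all Sinkhorn potentials with one common
  constant \<open>c\<close>: bounded above, and bounded below by minus the integrated cost. Such a potential \<open>f\<close> and
  the weight \<open>exp (- f)\<close> are integrable, and all estimates on transition kernels are uniform over the
  class.\<close>

definition admissible :: "'a measure \<Rightarrow> ('a \<Rightarrow> real) \<Rightarrow> real \<Rightarrow> ('a \<Rightarrow> real) \<Rightarrow> bool" where
  "admissible M h c f \<longleftrightarrow> f \<in> borel_measurable M \<and> (AE x in M. - h x - c \<le> f x \<and> f x \<le> c)"

lemma admissible_measurable[measurable_dest]: "admissible M h c f \<Longrightarrow> f \<in> borel_measurable M"
  by (simp add: admissible_def)

lemma admissible_bounds: "admissible M h c f \<Longrightarrow> AE x in M. - h x - c \<le> f x \<and> f x \<le> c"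
  by (simp add: admissible_def)

text \<open>\<open>M\<close> and \<open>N\<close> stand for the two prescribed marginals \<open>\<lambda>\<^sub>U\<close> and \<open>\<nu>\<^sub>V\<close>. Taking them as the reference
  measures removes \<open>U\<close> and \<open>V\<close> from the iteration: the potentials are then \<open>U\<^sub>2\<^sub>n - U\<close> and
  \<open>V\<^sub>2\<^sub>n - V\<close>. The functions \<open>\<phi>\<close> and \<open>\<psi>\<close> are multiples of the Lyapunov functions, and topology
  enters only through the growth conditions and the bound for \<open>w\<close> on sublevel sets. The setting is
  symmetric in the two spaces (lemma \<open>swap\<close>), so each half-step of the iteration is treated in one
  direction only.\<close>

locale lyapunov_cost = M: prob_space M + N: prob_space N
  for M :: "'a measure" and N :: "'b measure" +
  fixes w :: "'a \<Rightarrow> 'b \<Rightarrow> real" and \<phi> :: "'a \<Rightarrow> real" and \<psi> :: "'b \<Rightarrow> real" and C :: real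
  assumes w_meas[measurable]: "(\<lambda>(x, y). w x y) \<in> borel_measurable (M \<Otimes>\<^sub>M N)"
    and \<phi>_meas[measurable]: "\<phi> \<in> borel_measurable M" and \<psi>_meas[measurable]: "\<psi> \<in> borel_measurable N"
    and \<phi>_nonneg: "\<And>x. 0 \<le> \<phi> x" and \<psi>_nonneg: "\<And>y. 0 \<le> \<psi> y"
    and C_ge_1: "1 \<le> C"
    and exp_w_le: "AE z in M \<Otimes>\<^sub>M N. exp (- w (fst z) (snd z)) \<le> C"
    and w_int_N: "\<And>x. x \<in> space M \<Longrightarrow> integrable N (\<lambda>y. w x y)"
    and w_int_M: "\<And>y. y \<in> space N \<Longrightarrow> integrable M (\<lambda>x. w x y)"
    and lyap_M: "integrable M (\<lambda>x. exp (\<integral>y. w x y \<partial>N) * \<phi> x)"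
    and lyap_N: "integrable N (\<lambda>y. exp (\<integral>x. w x y \<partial>M) * \<psi> y)"
    and growth_M: "\<And>\<epsilon>. 0 < \<epsilon> \<Longrightarrow> \<exists>K. \<forall>x\<in>space M. exp (\<integral>y. w x y \<partial>N) \<le> \<epsilon> * \<phi> x + K"
    and growth_N: "\<And>\<epsilon>. 0 < \<epsilon> \<Longrightarrow> \<exists>K. \<forall>y\<in>space N. exp (\<integral>x. w x y \<partial>M) \<le> \<epsilon> * \<psi> y + K"
    and local_bound: "\<And>R. \<exists>\<omega>. \<forall>x\<in>space M. \<forall>y\<in>space N. \<phi> x \<le> R \<longrightarrow> \<psi> y \<le> R \<longrightarrow> w x y \<le> \<omega>"
begin

sublocale MN: pair_prob_space M N ..

lemma w_meas_swap[measurable]: "(\<lambda>(y, x). w x y) \<in> borel_measurable (N \<Otimes>\<^sub>M M)"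
  using measurable_compose[OF measurable_pair_swap'[of N M] w_meas] by (simp add: case_prod_beta')

lemma w_meas_N[measurable]: "x \<in> space M \<Longrightarrow> (\<lambda>y. w x y) \<in> borel_measurable N"
  using w_meas by measurable

text \<open>The integrated costs \<open>W\<^sup>V\<close> and \<open>W\<^sub>U\<close>.\<close>

abbreviation "a x \<equiv> (\<integral>y. w x y \<partial>N)"
abbreviation "b y \<equiv> (\<integral>x. w x y \<partial>M)"

lemma exp_w_le_MN: "AE x in M. AE y in N. exp (- w x y) \<le> C"
  using MN.AE_pair[OF exp_w_le] by simp

lemma w_meas_pair[measurable]: "(\<lambda>z. w (fst z) (snd z)) \<in> borel_measurable (M \<Otimes>\<^sub>M N)"
  using w_meas by (simp add: case_prod_beta')

lemma exp_w_le_NM: "AE y in N. AE x in M. exp (- w x y) \<le> C"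
proof (subst MN.AE_commute[symmetric])
  show "{z \<in> space (M \<Otimes>\<^sub>M N). exp (- w (fst z) (snd z)) \<le> C} \<in> sets (M \<Otimes>\<^sub>M N)" by measurable
qed (rule exp_w_le_MN)

lemma swap: "lyapunov_cost N M (\<lambda>y x. w x y) \<psi> \<phi> C"
proof -
  interpret NM: pair_prob_space N M ..
  have m: "(\<lambda>z. w (snd z) (fst z)) \<in> borel_measurable (N \<Otimes>\<^sub>M M)"
    using w_meas_swap by (simp add: case_prod_beta')
  have ae: "AE z in N \<Otimes>\<^sub>M M. exp (- w (snd z) (fst z)) \<le> C"
  proof (rule NM.AE_pair_measure)
    show "{z \<in> space (N \<Otimes>\<^sub>M M). exp (- w (snd z) (fst z)) \<le> C} \<in> sets (N \<Otimes>\<^sub>M M)"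
      using m by measurable
  qed (use exp_w_le_NM in simp)
  have lb: "\<exists>\<omega>. \<forall>y\<in>space N. \<forall>x\<in>space M. \<psi> y \<le> R \<longrightarrow> \<phi> x \<le> R \<longrightarrow> w x y \<le> \<omega>" for R
    using local_bound[of R] by blast
  show ?thesis
    apply (rule lyapunov_cost.intro[OF N.prob_space_axioms M.prob_space_axioms])
    apply (rule lyapunov_cost_axioms.intro)
    using \<phi>_nonneg \<psi>_nonneg C_ge_1 w_int_N w_int_M lyap_M lyap_N growth_M growth_N lb ae 
    apply simp_all
    done
qed

lemma a_ge: "AE x in M. - ln C \<le> a x"
  using exp_w_le_MN AE_space
proof eventually_elim
  case (elim x)
  have "AE y in N. - ln C \<le> w x y" using elim(1)
  proof eventually_elim
    case (elim y) then show ?case using C_ge_1 ln_le_cancel_iff[of "exp (- w x y)" C] by simp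
  qed
  then show ?case using elim w_int_N[of x] by (intro N.integral_ge_const) auto
qed

lemma a_meas[measurable]: "a \<in> borel_measurable M"
  by measurable

lemma \<phi>_int: "integrable M \<phi>"
proof (rule Bochner_Integration.integrable_bound)
  show "integrable M (\<lambda>x. C * (exp (a x) * \<phi> x))" using lyap_M by simp
  show "AE x in M. norm (\<phi> x) \<le> norm (C * (exp (a x) * \<phi> x))" using a_ge
  proof eventually_elim
    case (elim x)
    have "exp (- ln C) \<le> exp (a x)" using elim by simp
    then have "1 \<le> C * exp (a x)" using C_ge_1 by (simp add: exp_minus field_simps)
    then have "1 * \<phi> x \<le> C * exp (a x) * \<phi> x" by (intro mult_right_mono \<phi>_nonneg)
    then show ?case using \<phi>_nonneg[of x] C_ge_1 by (simp add: mult.assoc)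
  qed
qed simp

lemma exp_a_le:
  assumes "0 < \<epsilon>" shows "\<exists>K>0. \<forall>x\<in>space M. exp (a x) \<le> \<epsilon> * \<phi> x + K"
proof -
  obtain K where K: "\<forall>x\<in>space M. exp (a x) \<le> \<epsilon> * \<phi> x + K" using growth_M[OF assms] by blast
  show ?thesis by (rule exI[of _ "max K 1"]) (use K in \<open>fastforce simp: max_def\<close>)
qed

lemma exp_a_int: "integrable M (\<lambda>x. exp (a x))"
proof -
  obtain K where K: "K > 0" "\<And>x. x \<in> space M \<Longrightarrow> exp (a x) \<le> 1 * \<phi> x + K" using exp_a_le[of 1] by auto
  show ?thesis
  proof (rule Bochner_Integration.integrable_bound)
    show "integrable M (\<lambda>x. \<phi> x + K)" using \<phi>_int by simp
    show "AE x in M. norm (exp (a x)) \<le> norm (\<phi> x + K)"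
      using AE_space by eventually_elim (use K in force)
  qed simp
qed

lemma a_int: "integrable M a"
proof (rule Bochner_Integration.integrable_bound)
  show "integrable M (\<lambda>x. exp (a x) + ln C)" using exp_a_int by simp
  show "AE x in M. norm (a x) \<le> norm (exp (a x) + ln C)" using a_ge
  proof eventually_elim
    case (elim x)
    have "1 + a x \<le> exp (a x)" "0 \<le> ln C" "0 < exp (a x)" using C_ge_1 by auto
    then have "\<bar>a x\<bar> \<le> exp (a x) + ln C" using elim by linarith
    then show ?case by simp
  qed
qed simp

lemma admissible_int:
  assumes "admissible M a c f" shows "integrable M f"
proof (rule Bochner_Integration.integrable_bound)
  show "integrable M (\<lambda>x. \<bar>a x\<bar> + \<bar>c\<bar>)" using a_int by simp
  have "AE x in M. - a x - c \<le> f x \<and> f x \<le> c" using assms by (simp add: admissible_def)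
  then show "AE x in M. norm (f x) \<le> norm (\<bar>a x\<bar> + \<bar>c\<bar>)"
    by eventually_elim (simp, linarith)
qed (use assms in \<open>auto simp: admissible_def\<close>)

lemma admissible_exp_neg_int:
  assumes "admissible M a c f" shows "integrable M (\<lambda>x. exp (- f x))"
proof (rule Bochner_Integration.integrable_bound)
  show "integrable M (\<lambda>x. exp c * exp (a x))" using exp_a_int by simp
  show "AE x in M. norm (exp (- f x)) \<le> norm (exp c * exp (a x))"
    using assms unfolding admissible_def by (auto elim!: eventually_mono simp: exp_add[symmetric])
qed (use assms in \<open>auto simp: admissible_def\<close>)

end

section \<open>One half-step of the iteration\<close>

lemma log_partition_measurable:
  assumes "sigma_finite_measure N" and [measurable]: "(\<lambda>(x, y). w x y) \<in> borel_measurable (M \<Otimes>\<^sub>M N)" "g \<in> borel_measurable N"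
  shows "log_partition N w g \<in> borel_measurable M"
proof -
  interpret sigma_finite_measure N by fact
  show ?thesis unfolding log_partition_def by measurable
qed

context lyapunov_cost
begin

lemmas b_int = lyapunov_cost.a_int[OF swap]
lemmas exp_b_int = lyapunov_cost.exp_a_int[OF swap]
lemmas \<psi>_int = lyapunov_cost.\<phi>_int[OF swap]
lemmas admissible_N_int = lyapunov_cost.admissible_int[OF swap]
lemmas admissible_N_exp_neg_int = lyapunov_cost.admissible_exp_neg_int[OF swap]

lemma log_partition_M_measurable[measurable]:
  "g \<in> borel_measurable N \<Longrightarrow> log_partition N w g \<in> borel_measurable M"
  by (rule log_partition_measurable[OF N.sigma_finite_measure_axioms w_meas])

text \<open>The lower bound is Jensen's inequality, the upper bound is \<open>exp (- w) \<le> C\<close>. The lower bound also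
  shows that the integral is positive, so that the logarithm inverts the exponential.\<close>

lemma log_partition_bounds:
  assumes g: "admissible N b c g"
  shows "AE x in M. integrable N (\<lambda>y. exp (- w x y - g y)) \<and>
    exp (log_partition N w g x) = (\<integral>y. exp (- w x y - g y) \<partial>N) \<and>
    - a x - (\<integral>y. g y \<partial>N) \<le> log_partition N w g x \<and>
    exp (log_partition N w g x) \<le> C * (\<integral>y. exp (- g y) \<partial>N)"
  using exp_w_le_MN AE_space
proof eventually_elim
  case (elim x)
  note [measurable] = admissible_measurable[OF g] w_meas_N[OF elim(2)]
  have le: "AE y in N. exp (- w x y - g y) \<le> C * exp (- g y)"
    using elim(1)
  proof eventually_elim
    case (elim y)
    have "exp (- w x y) * exp (- g y) \<le> C * exp (- g y)" using elim by (intro mult_right_mono) auto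
    then show ?case by (simp add: exp_add[symmetric])
  qed
  have int: "integrable N (\<lambda>y. exp (- w x y - g y))"
  proof (rule Bochner_Integration.integrable_bound)
    show "integrable N (\<lambda>y. C * exp (- g y))" using admissible_N_exp_neg_int[OF g] by simp
    show "AE y in N. norm (exp (- w x y - g y)) \<le> norm (C * exp (- g y))"
      using le by eventually_elim (use C_ge_1 in simp)
  qed measurable
  have upper: "(\<integral>y. exp (- w x y - g y) \<partial>N) \<le> C * (\<integral>y. exp (- g y) \<partial>N)"
    using integral_mono_AE[OF int _ le] admissible_N_exp_neg_int[OF g] by simp
  have "exp (\<integral>y. - w x y - g y \<partial>N) \<le> (\<integral>y. exp (- w x y - g y) \<partial>N)"
    by (rule exp_integral_le_integral_exp[OF N.prob_space_axioms _ int])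
       (use w_int_N[OF elim(2)] admissible_N_int[OF g] in auto)
  also have "(\<integral>y. - w x y - g y \<partial>N) = - a x - (\<integral>y. g y \<partial>N)"
    using w_int_N[OF elim(2)] admissible_N_int[OF g] by simp
  finally have lower: "exp (- a x - (\<integral>y. g y \<partial>N)) \<le> (\<integral>y. exp (- w x y - g y) \<partial>N)" .
  then have pos: "0 < (\<integral>y. exp (- w x y - g y) \<partial>N)" by (rule less_le_trans[rotated]) simp
  then have "exp (log_partition N w g x) = (\<integral>y. exp (- w x y - g y) \<partial>N)"
    by (simp add: log_partition_def)
  moreover have "- a x - (\<integral>y. g y \<partial>N) \<le> log_partition N w g x"
    using lower pos by (simp add: log_partition_def ln_ge_iff)
  ultimately show ?case using int upper by simp
qed

lemma kernel_mass:
  assumes g: "admissible N b c g" and f: "f = log_partition N w g"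
  shows "AE x in M. (\<integral>\<^sup>+y. ennreal (exp (- w x y - f x - g y)) \<partial>N) = 1"
  using log_partition_bounds[OF g]
proof eventually_elim
  case (elim x)
  have e: "exp (- w x y - f x - g y) = exp (- f x) * exp (- w x y - g y)" for y
    by (rule trans[OF arg_cong[of _ _ exp] exp_add]) simp
  have "(\<integral>\<^sup>+y. ennreal (exp (- w x y - f x - g y)) \<partial>N) = (\<integral>\<^sup>+y. ennreal (exp (- f x) * exp (- w x y - g y)) \<partial>N)"
    by (simp only: e)
  also have "\<dots> = ennreal (\<integral>y. exp (- f x) * exp (- w x y - g y) \<partial>N)"
    using elim by (intro nn_integral_eq_integral) auto
  also have "(\<integral>y. exp (- f x) * exp (- w x y - g y) \<partial>N) = exp (- f x) * exp (f x)"
    using elim f by simp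
  finally show ?case by (simp add: exp_add[symmetric])
qed

text \<open>The two lower bounds on the potentials turn into \<open>exp (- f) \<le> exp (c + a)\<close> and
  \<open>exp (- g) \<le> exp (c + b)\<close>; the factor \<open>exp (b y)\<close> is what the weighted integrability of \<open>\<psi>\<close> allows
  for. Since \<open>exp a\<close> grows more slowly than \<open>\<phi>\<close>, this is a drift condition.\<close>

lemma kernel_drift:
  assumes g: "admissible N b c g" and f: "admissible M a c f"
  shows "AE x in M. (\<integral>\<^sup>+y. ennreal (exp (- w x y - f x - g y) * \<psi> y) \<partial>N)
    \<le> ennreal (C * exp (2 * c) * (\<integral>y. exp (b y) * \<psi> y \<partial>N) * exp (a x))"
  using exp_w_le_MN admissible_bounds[OF f]
proof eventually_elim
  case (elim x)
  have le: "AE y in N. exp (- w x y - f x - g y) * \<psi> y \<le> C * exp (2 * c) * exp (a x) * (exp (b y) * \<psi> y)"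
    using elim(1) admissible_bounds[OF g]
  proof eventually_elim
    case (elim y)
    have "exp (- w x y) * exp (- f x - g y) \<le> C * exp (2 * c + a x + b y)"
      using elim \<open>- a x - c \<le> f x \<and> f x \<le> c\<close> C_ge_1 by (intro mult_mono) auto
    moreover have "exp (- w x y) * exp (- f x - g y) = exp (- w x y - f x - g y)"
      by (subst exp_add[symmetric]) simp
    ultimately have "exp (- w x y - f x - g y) \<le> C * exp (2 * c) * exp (a x) * exp (b y)"
      by (simp add: exp_add mult.assoc)
    from mult_right_mono[OF this \<psi>_nonneg[of y]] show ?case by (simp add: mult.assoc)
  qed
  have "(\<integral>\<^sup>+y. ennreal (exp (- w x y - f x - g y) * \<psi> y) \<partial>N)
     \<le> (\<integral>\<^sup>+y. ennreal (C * exp (2 * c) * exp (a x) * (exp (b y) * \<psi> y)) \<partial>N)"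
    using le by (intro nn_integral_mono_AE) (auto elim!: eventually_mono intro: ennreal_leI)
  also have "\<dots> = ennreal (\<integral>y. C * exp (2 * c) * exp (a x) * (exp (b y) * \<psi> y) \<partial>N)"
    using lyap_N C_ge_1 \<psi>_nonneg by (intro nn_integral_eq_integral) auto
  also have "(\<integral>y. C * exp (2 * c) * exp (a x) * (exp (b y) * \<psi> y) \<partial>N)
     = C * exp (2 * c) * (\<integral>y. exp (b y) * \<psi> y \<partial>N) * exp (a x)" by simp
  finally show ?case .
qed

text \<open>\<open>exp (f' - f)\<close> is the density with respect to \<open>M\<close> of the first marginal of the plan with potentials
  \<open>f\<close> and \<open>g\<close>, and the choice of \<open>g\<close> makes that plan a probability measure with second marginal \<open>N\<close>.\<close>

lemma exp_diff_mean:
  assumes f: "admissible M a c f" and g: "admissible N b c g" "g = log_partition M (\<lambda>y x. w x y) f"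
    and f': "f' = log_partition N w g"
  shows "integrable M (\<lambda>x. exp (f' x - f x))" "(\<integral>x. exp (f' x - f x) \<partial>M) = 1"
proof -
  note [measurable] = admissible_measurable[OF f] admissible_measurable[OF g(1)]
  have [measurable]: "f' \<in> borel_measurable M" unfolding f' by measurable
  note m1 = kernel_mass[OF g(1) f']
  note m2 = lyapunov_cost.kernel_mass[OF swap f g(2)]
  have "(\<integral>\<^sup>+x. ennreal (exp (f' x - f x)) \<partial>M) = (\<integral>\<^sup>+x. (\<integral>\<^sup>+y. ennreal (exp (- w x y - f x - g y)) \<partial>N) \<partial>M)"
  proof (rule nn_integral_cong_AE)
    show "AE x in M. ennreal (exp (f' x - f x)) = (\<integral>\<^sup>+y. ennreal (exp (- w x y - f x - g y)) \<partial>N)"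
      using m1 AE_space[of M]
  proof eventually_elim
    case (elim x)
    note [measurable] = w_meas_N[OF elim(2)]
    have e: "exp (- w x y - f x - g y) = exp (f' x - f x) * exp (- w x y - f' x - g y)" for y
      by (rule trans[OF arg_cong[of _ _ exp] exp_add]) simp
    have "(\<integral>\<^sup>+y. ennreal (exp (- w x y - f x - g y)) \<partial>N)
        = (\<integral>\<^sup>+y. ennreal (exp (f' x - f x)) * ennreal (exp (- w x y - f' x - g y)) \<partial>N)"
      by (simp only: e ennreal_mult'[OF exp_ge_zero])
    also have "\<dots> = ennreal (exp (f' x - f x))"
      using elim by (subst nn_integral_cmult) auto
    finally show ?case ..
  qed
  qed
  also have "\<dots> = (\<integral>\<^sup>+y. (\<integral>\<^sup>+x. ennreal (exp (- w x y - f x - g y)) \<partial>M) \<partial>N)"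
    by (rule MN.Fubini'[symmetric]) measurable
  also have "\<dots> = (\<integral>\<^sup>+y. 1 \<partial>N)"
    using m2 by (intro nn_integral_cong_AE) (auto elim!: eventually_mono simp: algebra_simps)
  finally have *: "(\<integral>\<^sup>+x. ennreal (exp (f' x - f x)) \<partial>M) = 1" by (simp add: N.emeasure_space_1)
  then show "integrable M (\<lambda>x. exp (f' x - f x))" by (intro integrableI_nonneg) auto
  show "(\<integral>x. exp (f' x - f x) \<partial>M) = 1" using * by (subst integral_eq_nn_integral) auto
qed

text \<open>By Jensen's inequality, since \<open>exp (f' - f)\<close> has mean 1.\<close>

lemma mean_le:
  assumes f: "admissible M a c f" and g: "admissible N b c g" "g = log_partition M (\<lambda>y x. w x y) f"
    and f': "f' = log_partition N w g" "admissible M a c f'"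
  shows "(\<integral>x. f' x \<partial>M) \<le> (\<integral>x. f x \<partial>M)"
proof -
  have int: "integrable M f" "integrable M f'" using f f'(2) admissible_int by auto
  have "exp (\<integral>x. f' x - f x \<partial>M) \<le> 1"
    using exp_integral_le_integral_exp[OF M.prob_space_axioms, of "\<lambda>x. f' x - f x"] int
      exp_diff_mean[OF f g f'(1)] by simp
  then show ?thesis using int by simp
qed

text \<open>The transition kernel from the second space to the first with density \<open>exp (- w - f - g)\<close> sends the second
  marginal error \<open>exp (g - g0) - 1\<close> of one plan to the first marginal error \<open>1 - exp (f' - f)\<close> of the next.
  Its mass, drift and minorization properties put it in the scope of
  \<open>drift_minorization_contraction\<close>.\<close>

lemma half_step_contraction:
  assumes f: "admissible M a c f" "f = log_partition N w g0"
    and g0: "admissible N b c g0" and g: "admissible N b c g" "g = log_partition M (\<lambda>y x. w x y) f"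
    and f': "f' = log_partition N w g"
    and K: "0 < K" "\<And>y. y \<in> space N \<Longrightarrow> C * exp (2 * c) * (\<integral>x. exp (a x) * \<phi> x \<partial>M) * exp (b y) \<le> \<psi> y / 2 + K"
    and R: "48 * K \<le> R" "1 / 2 \<le> measure M {x \<in> space M. \<phi> x \<le> R}"
    and \<beta>: "0 < \<beta>" "\<beta> \<le> 1 / 8"
      "\<And>x y. x \<in> space M \<Longrightarrow> y \<in> space N \<Longrightarrow> \<phi> x \<le> R \<Longrightarrow> \<psi> y \<le> R \<Longrightarrow> \<beta> \<le> exp (- w x y - 2 * c)"
  shows "(\<integral>\<^sup>+x. ennreal (\<bar>1 - exp (f' x - f x)\<bar> * (1 + \<beta> / (4 * K) * \<phi> x)) \<partial>M)
    \<le> ennreal (1 - \<beta> / 4) * (\<integral>\<^sup>+y. ennreal (\<bar>exp (g y - g0 y) - 1\<bar> * (1 + \<beta> / (4 * K) * \<psi> y)) \<partial>N)"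
proof (rule drift_minorization_contraction[OF N.prob_space_axioms M.prob_space_axioms,
      where s = "\<lambda>y x. exp (- w x y - f x - g y)" and R = R])
  note [measurable] = admissible_measurable[OF f(1)] admissible_measurable[OF g(1)] admissible_measurable[OF g0]
  show "(\<lambda>(y, x). exp (- w x y - f x - g y)) \<in> borel_measurable (N \<Otimes>\<^sub>M M)"
    using w_meas_swap by (simp add: case_prod_beta')
  show "AE y in N. (\<integral>\<^sup>+x. ennreal (exp (- w x y - f x - g y)) \<partial>M) = 1"
    using lyapunov_cost.kernel_mass[OF swap f(1) g(2)] by (simp add: algebra_simps)
  show "AE y in N. (\<integral>\<^sup>+x. ennreal (exp (- w x y - f x - g y) * \<phi> x) \<partial>M) \<le> ennreal (\<psi> y / 2 + K)"
    using lyapunov_cost.kernel_drift[OF swap f(1) g(1)] AE_space[of N]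
  proof eventually_elim
    case (elim y)
    then show ?case using K(2)[of y] by (auto simp: algebra_simps intro: order_trans ennreal_leI)
  qed
  show "AE y in N. AE x in M. \<psi> y \<le> R \<longrightarrow> \<phi> x \<le> R \<longrightarrow> \<beta> \<le> exp (- w x y - f x - g y)"
    using admissible_bounds[OF g(1)] AE_space[of N]
  proof eventually_elim
    case (elim y)
    note y = elim
    show ?case using admissible_bounds[OF f(1)] AE_space[of M]
    proof eventually_elim
      case (elim x)
      have "exp (- w x y - 2 * c) \<le> exp (- w x y - f x - g y)" using elim y by simp
      then show ?case using \<beta>(3)[of x y] elim(2) y(2) by (auto intro: order_trans)
    qed
  qed
  show "integrable N (\<lambda>y. exp (g y - g0 y) - 1)" "(\<integral>y. exp (g y - g0 y) - 1 \<partial>N) = 0"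
    using lyapunov_cost.exp_diff_mean[OF swap g0 f g(2)] by (simp_all add: N.prob_space)
  show "(\<lambda>x. 1 - exp (f' x - f x)) \<in> borel_measurable M" unfolding f' by measurable
  show "AE x in M. integrable N (\<lambda>y. exp (- w x y - f x - g y) * (exp (g y - g0 y) - 1)) \<and>
    1 - exp (f' x - f x) = (\<integral>y. exp (- w x y - f x - g y) * (exp (g y - g0 y) - 1) \<partial>N)"
    using log_partition_bounds[OF g0] log_partition_bounds[OF g(1)]
  proof eventually_elim
    case (elim x)
    have eq: "exp (- w x y - f x - g y) * (exp (g y - g0 y) - 1)
      = exp (- f x) * (exp (- w x y - g0 y) - exp (- w x y - g y))" for y
      by (simp add: exp_diff exp_minus exp_add field_simps)
    have "1 - exp (f' x - f x) = exp (- f x) * (exp (f x) - exp (f' x))"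
      by (simp add: exp_diff exp_minus field_simps)
    then show ?case unfolding eq using elim f(2) f' by simp
  qed
qed (use K R \<beta> \<phi>_nonneg \<psi>_nonneg in auto)

end

section \<open>The Sinkhorn potentials\<close>

context lyapunov_cost
begin

text \<open>\<open>pot_f n\<close> is \<open>U\<^sub>2\<^sub>n - U\<close>. The index of the other sequence is shifted, \<open>pot_g n\<close> being
  \<open>V\<^sub>2\<^sub>n\<^sub>+\<^sub>2 - V\<close>: it is computed from \<open>pot_f n\<close>, and starting there avoids the initial value \<open>- V\<close>, which
  need not satisfy the uniform bounds.\<close>

fun pot_f :: "nat \<Rightarrow> 'a \<Rightarrow> real" and pot_g :: "nat \<Rightarrow> 'b \<Rightarrow> real" where
  "pot_f 0 = (\<lambda>x. 0)"
| "pot_f (Suc n) = log_partition N w (pot_g n)"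
| "pot_g n = log_partition M (\<lambda>y x. w x y) (pot_f n)"

declare pot_g.simps[simp del] pot_f.simps(2)[simp del]

definition potential_bound :: real where
  "potential_bound = 2 * ln C + \<bar>ln (\<integral>x. exp (a x) \<partial>M)\<bar> + \<bar>ln (\<integral>y. exp (b y) \<partial>N)\<bar>"

lemma log_partition_le:
  assumes "admissible N b c g" and le: "AE y in N. - b y - k \<le> g y"
  shows "AE x in M. log_partition N w g x \<le> ln C + k + ln (\<integral>y. exp (b y) \<partial>N)"
  using log_partition_bounds[OF assms(1)]
proof eventually_elim
  case (elim x)
  have pos: "0 < (\<integral>y. exp (b y) \<partial>N)"
    using exp_integral_le_integral_exp[OF N.prob_space_axioms b_int exp_b_int]
    by (rule less_le_trans[rotated]) simp
  have "(\<integral>y. exp (- g y) \<partial>N) \<le> (\<integral>y. exp k * exp (b y) \<partial>N)"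
  proof (rule integral_mono_AE)
    show "AE y in N. exp (- g y) \<le> exp k * exp (b y)"
      using le by eventually_elim (simp add: exp_add[symmetric])
  qed (use admissible_N_exp_neg_int[OF assms(1)] exp_b_int in auto)
  then have "C * (\<integral>y. exp (- g y) \<partial>N) \<le> C * (exp k * (\<integral>y. exp (b y) \<partial>N))"
    using C_ge_1 by (intro mult_left_mono) auto
  then have "exp (log_partition N w g x) \<le> C * (exp k * (\<integral>y. exp (b y) \<partial>N))" using elim by linarith
  also have "\<dots> = exp (ln C + k + ln (\<integral>y. exp (b y) \<partial>N))"
    using C_ge_1 pos by (simp add: exp_add)
  finally show ?case by simp
qed

lemma admissible_zero: "admissible M a potential_bound (\<lambda>_. 0)"
  unfolding admissible_def using a_ge
proof (intro conjI, measurable, eventually_elim)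
  case (elim x)
  have "0 \<le> ln C" "ln C \<le> potential_bound" using C_ge_1 by (auto simp: potential_bound_def)
  then show ?case using elim by linarith
qed

lemma potential_bound_nonneg: "0 \<le> potential_bound"
  using C_ge_1 by (simp add: potential_bound_def)

text \<open>A bound on the mean of a potential gives, by Jensen's inequality, a lower bound on the next potential;
  that lower bound gives an upper bound on the potential after it. Hence control of the means, which
  decrease along the iteration, is enough for uniform bounds. The term \<open>- b y - 0\<close> is the
  instance \<open>k = 0\<close> of the hypothesis of \<open>log_partition_le\<close>.\<close>

lemma pot_g_step_bounds:
  assumes f: "admissible M a potential_bound f" "(\<integral>x. f x \<partial>M) \<le> 0" "AE x in M. - a x - ln C \<le> f x"
    and g: "g = log_partition M (\<lambda>y x. w x y) f"
  shows "admissible N b potential_bound g" "AE y in N. - b y - 0 \<le> g y"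
proof -
  note [measurable] = admissible_measurable[OF f(1)]
  note bounds = lyapunov_cost.log_partition_bounds[OF swap f(1), folded g]
  note le = lyapunov_cost.log_partition_le[OF swap f(1) f(3), folded g]
  show lower: "AE y in N. - b y - 0 \<le> g y"
    using bounds by eventually_elim (use f(2) in linarith)
  have "AE y in N. - b y - potential_bound \<le> g y \<and> g y \<le> potential_bound"
    using lower le by eventually_elim (use potential_bound_nonneg in \<open>auto simp: potential_bound_def\<close>)
  moreover have "g \<in> borel_measurable N"
    unfolding g by (rule lyapunov_cost.log_partition_M_measurable[OF swap]) measurable
  ultimately show "admissible N b potential_bound g" by (simp add: admissible_def)
qed

lemma pot_f_step_bounds:
  assumes g: "admissible N b potential_bound g" "(\<integral>y. g y \<partial>N) \<le> ln C" "AE y in N. - b y - 0 \<le> g y"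
    and f: "f = log_partition N w g"
  shows "admissible M a potential_bound f" "AE x in M. - a x - ln C \<le> f x"
proof -
  note [measurable] = admissible_measurable[OF g(1)]
  note bounds = log_partition_bounds[OF g(1), folded f]
  note le = log_partition_le[OF g(1) g(3), folded f]
  have C: "0 \<le> ln C" using C_ge_1 by simp
  show lower: "AE x in M. - a x - ln C \<le> f x"
    using bounds by eventually_elim (use g(2) in linarith)
  have "AE x in M. - a x - potential_bound \<le> f x \<and> f x \<le> potential_bound"
    using lower le by eventually_elim (use potential_bound_nonneg C in \<open>auto simp: potential_bound_def\<close>)
  moreover have "f \<in> borel_measurable M" unfolding f by measurable
  ultimately show "admissible M a potential_bound f" by (simp add: admissible_def)
qed

lemma potential_invariants:
  "admissible M a potential_bound (pot_f n) \<and> (\<integral>x. pot_f n x \<partial>M) \<le> 0 \<and> (AE x in M. - a x - ln C \<le> pot_f n x) \<and>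
   admissible N b potential_bound (pot_g n) \<and> (\<integral>y. pot_g n y \<partial>N) \<le> ln C \<and> (AE y in N. - b y - 0 \<le> pot_g n y)"
proof (induction n)
  case 0
  have f: "admissible M a potential_bound (pot_f 0)" "(\<integral>x. pot_f 0 x \<partial>M) \<le> 0" "AE x in M. - a x - ln C \<le> pot_f 0 x"
    using admissible_zero a_ge by auto
  note g = pot_g_step_bounds[OF f pot_g.simps]
  have "AE y in N. pot_g 0 y \<le> ln C"
    using lyapunov_cost.log_partition_bounds[OF swap f(1)]
  proof eventually_elim
    case (elim y)
    then have "exp (pot_g 0 y) \<le> exp (ln C)" using C_ge_1 by (simp add: pot_g.simps M.prob_space)
    then show ?case by (simp only: exp_le_cancel_iff)
  qed
  then have "(\<integral>y. pot_g 0 y \<partial>N) \<le> ln C"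
    using admissible_N_int[OF g(1)] by (intro N.integral_le_const)
  then show ?case using f g by simp
next
  case (Suc n)
  note f = pot_f_step_bounds[OF _ _ _ pot_f.simps(2), of n]
  have f: "admissible M a potential_bound (pot_f (Suc n))" "AE x in M. - a x - ln C \<le> pot_f (Suc n) x"
    using Suc f by auto
  have "(\<integral>x. pot_f (Suc n) x \<partial>M) \<le> (\<integral>x. pot_f n x \<partial>M)"
    using Suc f by (intro mean_le[OF _ _ pot_g.simps pot_f.simps(2)]) auto
  then have f0: "(\<integral>x. pot_f (Suc n) x \<partial>M) \<le> 0" using Suc by linarith
  note g = pot_g_step_bounds[OF f(1) f0 f(2) pot_g.simps]
  have "(\<integral>y. pot_g (Suc n) y \<partial>N) \<le> (\<integral>y. pot_g n y \<partial>N)"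
    using Suc f g by (intro lyapunov_cost.mean_le[OF swap _ _ pot_f.simps(2) pot_g.simps]) auto
  then show ?case using Suc f f0 g by auto
qed

lemma pot_f_admissible: "admissible M a potential_bound (pot_f n)"
  and pot_g_admissible: "admissible N b potential_bound (pot_g n)"
  using potential_invariants[of n] by auto

lemma pot_f_measurable[measurable]: "pot_f n \<in> borel_measurable M"
  and pot_g_measurable[measurable]: "pot_g n \<in> borel_measurable N"
  using pot_f_admissible pot_g_admissible by (auto simp: admissible_def)

lemma pot_f_int: "integrable M (pot_f n)" and pot_g_int: "integrable N (pot_g n)"
  using admissible_int[OF pot_f_admissible] admissible_N_int[OF pot_g_admissible] by auto

lemma exp_diff_weight_int:
  assumes "admissible M a c f" "admissible M a c f'"
  shows "integrable M (\<lambda>x. \<bar>exp (f' x - f x) - 1\<bar> * (1 + k * \<phi> x))"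
proof (rule Bochner_Integration.integrable_bound)
  show "integrable M (\<lambda>x. (exp (2 * c) * exp (a x) + 1) + (\<bar>k\<bar> * exp (2 * c) * (exp (a x) * \<phi> x) + \<bar>k\<bar> * \<phi> x))"
    using exp_a_int lyap_M \<phi>_int by simp
  show "AE x in M. norm (\<bar>exp (f' x - f x) - 1\<bar> * (1 + k * \<phi> x))
    \<le> norm ((exp (2 * c) * exp (a x) + 1) + (\<bar>k\<bar> * exp (2 * c) * (exp (a x) * \<phi> x) + \<bar>k\<bar> * \<phi> x))"
    using admissible_bounds[OF assms(1)] admissible_bounds[OF assms(2)]
  proof eventually_elim
    case (elim x)
    have "exp (f' x - f x) \<le> exp (2 * c + a x)" using elim by simp
    then have "\<bar>exp (f' x - f x) - 1\<bar> \<le> exp (2 * c) * exp (a x) + 1"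
      unfolding exp_add using exp_gt_zero[of "f' x - f x"] by linarith
    moreover have "\<bar>1 + k * \<phi> x\<bar> \<le> 1 + \<bar>k\<bar> * \<phi> x"
      using \<phi>_nonneg[of x] abs_triangle_ineq[of 1 "k * \<phi> x"] by (simp add: abs_mult)
    ultimately have "\<bar>exp (f' x - f x) - 1\<bar> * \<bar>1 + k * \<phi> x\<bar>
      \<le> (exp (2 * c) * exp (a x) + 1) * (1 + \<bar>k\<bar> * \<phi> x)"
      by (intro mult_mono) auto
    also have "\<dots> = (exp (2 * c) * exp (a x) + 1) + (\<bar>k\<bar> * exp (2 * c) * (exp (a x) * \<phi> x) + \<bar>k\<bar> * \<phi> x)"
      by (simp add: algebra_simps)
    finally show ?case
      unfolding real_norm_def abs_mult[of _ "1 + k * \<phi> x"] abs_idempotent by (rule order_trans[OF _ abs_ge_self])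
  qed
qed (use assms in \<open>auto simp: admissible_def\<close>)

end

section \<open>Geometric decay of the marginal errors\<close>

text \<open>The increments are summable in \<open>L\<^sup>1\<close>, hence almost everywhere, and the majorant \<open>G\<close> allows for
  dominated convergence.\<close>

lemma geometric_L1_limit:
  fixes h :: "nat \<Rightarrow> 'a \<Rightarrow> real"
  assumes int: "\<And>n. integrable M (h n)" and G: "integrable M G" "\<And>n. AE x in M. \<bar>h n x\<bar> \<le> G x"
    and le: "\<And>n. (\<integral>x. \<bar>h n x - h (Suc n) x\<bar> \<partial>M) \<le> c * q ^ n" and q: "0 \<le> q" "q < 1"
  obtains l where "l \<in> borel_measurable M" "AE x in M. (\<lambda>n. h n x) \<longlonglongrightarrow> l x"
    "(\<lambda>n. \<integral>x. h n x \<partial>M) \<longlonglongrightarrow> (\<integral>x. l x \<partial>M)"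
    "\<And>n. \<bar>(\<integral>x. h n x \<partial>M) - (\<integral>x. l x \<partial>M)\<bar> \<le> c / (1 - q) * q ^ n"
proof -
  have [measurable]: "h n \<in> borel_measurable M" for n using int by auto
  have c0: "0 \<le> c"
    using order_trans[OF integral_nonneg_AE le[of 0]] by auto
  have "(\<integral>\<^sup>+x. (\<Sum>n. ennreal \<bar>h n x - h (Suc n) x\<bar>) \<partial>M) = (\<Sum>n. \<integral>\<^sup>+x. ennreal \<bar>h n x - h (Suc n) x\<bar> \<partial>M)"
    by (rule nn_integral_suminf) measurable
  also have "\<dots> \<le> (\<Sum>n. ennreal (c * q ^ n))"
    using int le by (intro suminf_le) (auto simp: nn_integral_eq_integral intro!: ennreal_leI)
  also have "\<dots> = ennreal (\<Sum>n. c * q ^ n)"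
    using c0 q by (intro suminf_ennreal2) (auto intro!: summable_mult summable_geometric)
  finally have "(\<integral>\<^sup>+x. (\<Sum>n. ennreal \<bar>h n x - h (Suc n) x\<bar>) \<partial>M) \<noteq> \<infinity>"
    by (auto simp: top_unique)
  then have "AE x in M. (\<Sum>n. ennreal \<bar>h n x - h (Suc n) x\<bar>) \<noteq> \<infinity>"
    by (intro nn_integral_PInf_AE) auto
  then have conv: "AE x in M. convergent (\<lambda>n. h n x)"
  proof eventually_elim
    case (elim x)
    have "summable (\<lambda>n. \<bar>h n x - h (Suc n) x\<bar>)"
      using elim by (intro summable_suminf_not_top) auto
    then have "summable (\<lambda>n. h n x - h (Suc n) x)" by (rule summable_rabs_cancel)
    then have "convergent (\<lambda>n. \<Sum>i<n. h i x - h (Suc i) x)" by (simp add: summable_iff_convergent)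
    then have "convergent (\<lambda>n. h 0 x - h n x)" by (simp only: sum_lessThan_telescope'[of "\<lambda>i. h i x"])
    from convergent_diff[OF convergent_const[of "h 0 x"] this] show ?case by simp
  qed
  define l where "l x = lim (\<lambda>n. h n x)" for x
  have [measurable]: "l \<in> borel_measurable M" unfolding l_def by measurable
  have lim: "AE x in M. (\<lambda>n. h n x) \<longlonglongrightarrow> l x"
    using conv by eventually_elim (simp add: l_def convergent_LIMSEQ_iff)
  have lim_int: "(\<lambda>n. \<integral>x. h n x \<partial>M) \<longlonglongrightarrow> (\<integral>x. l x \<partial>M)"
    by (rule integral_dominated_convergence[OF _ _ G(1) lim]) (use G in auto)
  have step: "\<bar>(\<integral>x. h n x \<partial>M) - (\<integral>x. h (Suc n) x \<partial>M)\<bar> \<le> c * q ^ n" for n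
  proof -
    have "(\<integral>x. h n x \<partial>M) - (\<integral>x. h (Suc n) x \<partial>M) = (\<integral>x. h n x - h (Suc n) x \<partial>M)" using int by simp
    then show ?thesis using order_trans[OF integral_abs_bound le[of n]] by simp
  qed
  have tele: "\<bar>(\<integral>x. h n x \<partial>M) - (\<integral>x. h (n + m) x \<partial>M)\<bar> \<le> c / (1 - q) * q ^ n * (1 - q ^ m)" for n m
  proof (induction m)
    case (Suc m)
    have "\<bar>(\<integral>x. h n x \<partial>M) - (\<integral>x. h (n + Suc m) x \<partial>M)\<bar>
       \<le> c / (1 - q) * q ^ n * (1 - q ^ m) + c * q ^ (n + m)"
      using Suc step[of "n + m"] by simp
    also have "\<dots> = c / (1 - q) * q ^ n * (1 - q ^ Suc m)"
      using q by (simp add: field_simps power_add)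
    finally show ?case .
  qed simp
  have "\<bar>(\<integral>x. h n x \<partial>M) - (\<integral>x. l x \<partial>M)\<bar> \<le> c / (1 - q) * q ^ n" for n
  proof (rule tendsto_upperbound)
    show "(\<lambda>m. \<bar>(\<integral>x. h n x \<partial>M) - (\<integral>x. h (n + m) x \<partial>M)\<bar>) \<longlonglongrightarrow> \<bar>(\<integral>x. h n x \<partial>M) - (\<integral>x. l x \<partial>M)\<bar>"
      using LIMSEQ_ignore_initial_segment[OF lim_int, of n] by (intro tendsto_intros) (simp add: add.commute)
    show "\<forall>\<^sub>F m in sequentially. \<bar>(\<integral>x. h n x \<partial>M) - (\<integral>x. h (n + m) x \<partial>M)\<bar> \<le> c / (1 - q) * q ^ n"
    proof (intro always_eventually allI)
      fix m
      have "c / (1 - q) * q ^ n * (1 - q ^ m) \<le> c / (1 - q) * q ^ n * 1"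
        using c0 q by (intro mult_left_mono) auto
      then show "\<bar>(\<integral>x. h n x \<partial>M) - (\<integral>x. h (n + m) x \<partial>M)\<bar> \<le> c / (1 - q) * q ^ n" using tele[of n m] by simp
    qed
  qed simp
  then show ?thesis using lim lim_int by (intro that) auto
qed

context lyapunov_cost
begin

lemma scaled_exp_a_le:
  assumes "0 \<le> D" shows "\<exists>K>0. \<forall>x\<in>space M. D * exp (a x) \<le> \<phi> x / 2 + K"
proof -
  have "0 < 1 / (2 * (D + 1))" using assms by simp
  from exp_a_le[OF this] obtain K where
    K: "0 < K" "\<And>x. x \<in> space M \<Longrightarrow> exp (a x) \<le> 1 / (2 * (D + 1)) * \<phi> x + K" by blast
  have "D * exp (a x) \<le> \<phi> x / 2 + (D + 1) * K" if "x \<in> space M" for x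
  proof -
    have "D * exp (a x) \<le> (D + 1) * exp (a x)" by simp
    also have "\<dots> \<le> (D + 1) * (1 / (2 * (D + 1)) * \<phi> x + K)"
      using assms K(2)[OF that] by (intro mult_left_mono) auto
    also have "\<dots> = \<phi> x / 2 + (D + 1) * K" using assms by (simp add: field_simps)
    finally show ?thesis .
  qed
  then show ?thesis using K(1) assms by (intro exI[of _ "(D + 1) * K"]) auto
qed

text \<open>Markov's inequality.\<close>

lemma sublevel_mass_ge_half:
  assumes R: "2 * (\<integral>x. \<phi> x \<partial>M) + 1 \<le> R"
  shows "1 / 2 \<le> measure M {x \<in> space M. \<phi> x \<le> R}"
proof -
  have I: "0 \<le> (\<integral>x. \<phi> x \<partial>M)" using \<phi>_nonneg by simp
  then have R0: "0 < R" using R by simp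
  have "(\<integral>x. 1 - \<phi> x / R \<partial>M) \<le> (\<integral>x. indicator {x \<in> space M. \<phi> x \<le> R} x \<partial>M)"
  proof (rule integral_mono)
    fix x assume "x \<in> space M"
    then show "1 - \<phi> x / R \<le> indicator {x \<in> space M. \<phi> x \<le> R} x"
      using R0 \<phi>_nonneg[of x] by (auto simp: indicator_def field_simps)
  qed (use \<phi>_int in \<open>auto intro!: integrable_real_indicator simp: M.emeasure_eq_measure\<close>)
  moreover have "(\<integral>x. 1 - \<phi> x / R \<partial>M) = 1 - (\<integral>x. \<phi> x \<partial>M) / R"
    using \<phi>_int by (simp add: M.prob_space)
  moreover have "(\<integral>x. \<phi> x \<partial>M) / R \<le> 1 / 2" using R R0 I by (simp add: field_simps)
  ultimately show ?thesis by simp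
qed

text \<open>With \<open>d = f - f'\<close> and \<open>u = exp (- d) - 1\<close>, convexity gives \<open>d + u \<le> \<bar>d\<bar> \<bar>u\<bar>\<close>, where \<open>u\<close> has mean zero
  and \<open>\<bar>d\<bar>\<close> is bounded by a multiple of the weight. So the mean of \<open>d\<close>, which is a relative entropy, is
  of first order in the weighted norm of \<open>u\<close>. The negative part of \<open>d\<close> is at most \<open>\<bar>u\<bar>\<close>, which
  upgrades the estimate to the mean of \<open>\<bar>d\<bar>\<close>.\<close>

lemma L1_le_weighted:
  assumes k: "0 < k"
  shows "\<exists>L\<ge>0. \<forall>f f'. admissible M a c f \<longrightarrow> admissible M a c f' \<longrightarrow> integrable M (\<lambda>x. exp (f' x - f x)) \<longrightarrow>
    (\<integral>x. exp (f' x - f x) \<partial>M) = 1 \<longrightarrow>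
    (\<integral>x. \<bar>f x - f' x\<bar> \<partial>M) \<le> L * (\<integral>x. \<bar>exp (f' x - f x) - 1\<bar> * (1 + k * \<phi> x) \<partial>M)"
proof -
  obtain K where K: "0 < K" "\<And>x. x \<in> space M \<Longrightarrow> exp (a x) \<le> 1 * \<phi> x + K" using exp_a_le[of 1] by auto
  define L where "L = 1 / k + K + 2 * \<bar>c\<bar>"
  have L0: "0 \<le> L" using k K by (simp add: L_def)
  have "(\<integral>x. \<bar>f x - f' x\<bar> \<partial>M) \<le> (L + 2) * (\<integral>x. \<bar>exp (f' x - f x) - 1\<bar> * (1 + k * \<phi> x) \<partial>M)"
    if f: "admissible M a c f" and f': "admissible M a c f'" and int: "integrable M (\<lambda>x. exp (f' x - f x))"
      and one: "(\<integral>x. exp (f' x - f x) \<partial>M) = 1" for f f'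
  proof -
    let ?u = "\<lambda>x. exp (f' x - f x) - 1"
    note wint = exp_diff_weight_int[OF f f', of k]
    have "(\<integral>x. \<bar>f x - f' x\<bar> \<partial>M) \<le> (\<integral>x. (L + 2) * (\<bar>?u x\<bar> * (1 + k * \<phi> x)) - ?u x \<partial>M)"
    proof (rule integral_mono_AE)
      show "AE x in M. \<bar>f x - f' x\<bar> \<le> (L + 2) * (\<bar>?u x\<bar> * (1 + k * \<phi> x)) - ?u x"
        using admissible_bounds[OF f] admissible_bounds[OF f'] AE_space[of M]
      proof eventually_elim
        case (elim x)
        let ?d = "f x - f' x"
        have aux: "\<bar>d\<bar> \<le> d + 2 * \<bar>u\<bar>" if "- d \<le> u" for d u :: real
          using that by (auto simp: abs_if)
        have "a x \<le> \<phi> x + K" using K(2)[OF elim(3)] exp_ge_add_one_self[of "a x"] by linarith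
        moreover have "\<bar>?d\<bar> \<le> a x + 2 * c" using elim by linarith
        ultimately have d1: "\<bar>?d\<bar> \<le> \<phi> x + K + 2 * \<bar>c\<bar>" by linarith
        have "L * (1 + k * \<phi> x) = \<phi> x + 1 / k + K + 2 * \<bar>c\<bar> + (K + 2 * \<bar>c\<bar>) * k * \<phi> x"
          using k by (simp add: L_def field_simps)
        moreover have "0 \<le> (K + 2 * \<bar>c\<bar>) * k * \<phi> x" using k K \<phi>_nonneg[of x] by simp
        moreover have "0 \<le> 1 / k" using k by simp
        ultimately have d: "\<bar>?d\<bar> \<le> L * (1 + k * \<phi> x)" using d1 by linarith
        have "exp (- ?d) * (1 + ?d) \<le> exp (- ?d) * exp ?d"
          by (intro mult_left_mono exp_ge_add_one_self) auto
        then have "?u x \<le> - ?d * exp (- ?d)" by (simp add: exp_add[symmetric] algebra_simps)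
        then have "?d + ?u x \<le> - ?d * ?u x" by (simp add: algebra_simps)
        also have "\<dots> \<le> \<bar>?d\<bar> * \<bar>?u x\<bar>" using abs_ge_self[of "- ?d * ?u x"] by (simp only: abs_mult abs_minus)
        also have "\<dots> \<le> L * (1 + k * \<phi> x) * \<bar>?u x\<bar>" using d by (intro mult_right_mono) auto
        finally have 1: "?d + ?u x \<le> L * (\<bar>?u x\<bar> * (1 + k * \<phi> x))" by (simp add: ac_simps)
        have "1 + (f' x - f x) \<le> exp (f' x - f x)" by (rule exp_ge_add_one_self)
        then have "- ?d \<le> ?u x" by linarith
        then have "\<bar>?d\<bar> \<le> ?d + 2 * \<bar>?u x\<bar>"
          by (rule aux)
        moreover have "\<bar>?u x\<bar> * 1 \<le> \<bar>?u x\<bar> * (1 + k * \<phi> x)"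
          using k \<phi>_nonneg[of x] by (intro mult_left_mono) auto
        ultimately show ?case using 1 by (simp only: distrib_right)
      qed
    qed (use wint int admissible_int[OF f] admissible_int[OF f'] in auto)
    also have "\<dots> = (L + 2) * (\<integral>x. \<bar>?u x\<bar> * (1 + k * \<phi> x) \<partial>M)"
      using wint int one by (simp add: M.prob_space)
    finally show ?thesis .
  qed
  then show ?thesis using L0 by (intro exI[of _ "L + 2"]) auto
qed

text \<open>Common constants for the two directions are chosen in the order \<open>K\<close> (drift), \<open>R\<close> (sublevel sets of
  mass at least one half), \<open>\<beta>\<close> (minorization on these sets).\<close>

lemma geometric_contraction:
  "\<exists>k \<rho> E. 0 < k \<and> 0 < \<rho> \<and> \<rho> < 1 \<and> 0 \<le> E \<and>
    (\<forall>n. (\<integral>x. \<bar>exp (pot_f (Suc n) x - pot_f n x) - 1\<bar> * (1 + k * \<phi> x) \<partial>M) \<le> E * (\<rho> ^ 2) ^ n) \<and>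
    (\<forall>n. (\<integral>y. \<bar>exp (pot_g (Suc n) y - pot_g n y) - 1\<bar> * (1 + k * \<psi> y) \<partial>N) \<le> E * (\<rho> ^ 2) ^ n)"
proof -
  define DM where "DM = C * exp (2 * potential_bound) * (\<integral>x. exp (a x) * \<phi> x \<partial>M)"
  define DN where "DN = C * exp (2 * potential_bound) * (\<integral>y. exp (b y) * \<psi> y \<partial>N)"
  have "0 \<le> DM" "0 \<le> DN" using C_ge_1 \<phi>_nonneg \<psi>_nonneg by (auto simp: DM_def DN_def)
  then obtain K1 K2 where K1: "0 < K1" "\<And>x. x \<in> space M \<Longrightarrow> DN * exp (a x) \<le> \<phi> x / 2 + K1"
    and K2: "0 < K2" "\<And>y. y \<in> space N \<Longrightarrow> DM * exp (b y) \<le> \<psi> y / 2 + K2"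
    using scaled_exp_a_le[of DN] lyapunov_cost.scaled_exp_a_le[OF swap, of DM] by auto
  define K where "K = K1 + K2"
  have K: "0 < K" "\<And>x. x \<in> space M \<Longrightarrow> DN * exp (a x) \<le> \<phi> x / 2 + K"
    "\<And>y. y \<in> space N \<Longrightarrow> DM * exp (b y) \<le> \<psi> y / 2 + K"
    using K1 K2 by (force simp: K_def)+
  define R where "R = 48 * K + \<bar>2 * (\<integral>x. \<phi> x \<partial>M) + 1\<bar> + \<bar>2 * (\<integral>y. \<psi> y \<partial>N) + 1\<bar>"
  have R': "48 * K \<le> R" "2 * (\<integral>x. \<phi> x \<partial>M) + 1 \<le> R" "2 * (\<integral>y. \<psi> y \<partial>N) + 1 \<le> R"
    unfolding R_def using K(1) by linarith+
  have R: "48 * K \<le> R" "1 / 2 \<le> measure M {x \<in> space M. \<phi> x \<le> R}" "1 / 2 \<le> measure N {y \<in> space N. \<psi> y \<le> R}"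
    using R' sublevel_mass_ge_half lyapunov_cost.sublevel_mass_ge_half[OF swap] by blast+
  obtain \<omega> where \<omega>: "\<And>x y. x \<in> space M \<Longrightarrow> y \<in> space N \<Longrightarrow> \<phi> x \<le> R \<Longrightarrow> \<psi> y \<le> R \<Longrightarrow> w x y \<le> \<omega>"
    using local_bound[of R] by blast
  define \<beta> where "\<beta> = min (1 / 8) (exp (- \<omega> - 2 * potential_bound))"
  have \<beta>: "0 < \<beta>" "\<beta> \<le> 1 / 8" by (auto simp: \<beta>_def)
  have \<beta>w: "\<beta> \<le> exp (- w x y - 2 * potential_bound)"
    if "x \<in> space M" "y \<in> space N" "\<phi> x \<le> R" "\<psi> y \<le> R" for x y
  proof -
    have "exp (- \<omega> - 2 * potential_bound) \<le> exp (- w x y - 2 * potential_bound)" using \<omega>[OF that] by simp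
    then show ?thesis unfolding \<beta>_def by linarith
  qed
  define k where "k = \<beta> / (4 * K)"
  define \<rho> where "\<rho> = 1 - \<beta> / 4"
  have k: "0 < k" and \<rho>: "0 < \<rho>" "\<rho> < 1" using \<beta> K by (auto simp: k_def \<rho>_def)
  define B where "B n = (\<integral>x. \<bar>exp (pot_f (Suc n) x - pot_f n x) - 1\<bar> * (1 + k * \<phi> x) \<partial>M)" for n
  define A where "A n = (\<integral>y. \<bar>exp (pot_g (Suc n) y - pot_g n y) - 1\<bar> * (1 + k * \<psi> y) \<partial>N)" for n
  have w0: "0 \<le> 1 + k * \<phi> x" "0 \<le> 1 + k * \<psi> y" for x y using k \<phi>_nonneg[of x] \<psi>_nonneg[of y] by auto
  have B_nn: "(\<integral>\<^sup>+x. ennreal (\<bar>exp (pot_f (Suc n) x - pot_f n x) - 1\<bar> * (1 + k * \<phi> x)) \<partial>M) = ennreal (B n)" for n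
    unfolding B_def using w0
    by (intro nn_integral_eq_integral exp_diff_weight_int[OF pot_f_admissible pot_f_admissible]) auto
  have A_nn: "(\<integral>\<^sup>+y. ennreal (\<bar>exp (pot_g (Suc n) y - pot_g n y) - 1\<bar> * (1 + k * \<psi> y)) \<partial>N) = ennreal (A n)" for n
    unfolding A_def using w0
    by (intro nn_integral_eq_integral lyapunov_cost.exp_diff_weight_int[OF swap pot_g_admissible pot_g_admissible]) auto
  have A0: "0 \<le> A n" and B0: "0 \<le> B n" for n
    using w0 by (auto simp: A_def B_def intro!: integral_nonneg_AE)
  \<comment> \<open>The two marginal errors alternate: each is a contraction of the previous one.\<close>
  have BA: "B (Suc n) \<le> \<rho> * A n" for n
  proof -
    have "ennreal (B (Suc n)) \<le> ennreal \<rho> * ennreal (A n)"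
      using half_step_contraction[OF pot_f_admissible pot_f.simps(2) pot_g_admissible pot_g_admissible pot_g.simps pot_f.simps(2)
         K(1) K(3)[unfolded DM_def] R(1,2) \<beta> \<beta>w, of n]
      unfolding A_nn[symmetric] B_nn[symmetric] k_def \<rho>_def by (simp add: abs_minus_commute)
    then show ?thesis using \<rho> A0 by (simp add: ennreal_mult[symmetric] ennreal_le_iff)
  qed
  have AB: "A n \<le> \<rho> * B n" for n
  proof -
    have "ennreal (A n) \<le> ennreal \<rho> * ennreal (B n)"
      using lyapunov_cost.half_step_contraction[OF swap pot_g_admissible pot_g.simps pot_f_admissible pot_f_admissible pot_f.simps(2) pot_g.simps
         K(1) K(2)[unfolded DN_def] R(1,3) \<beta> \<beta>w, of n]
      unfolding A_nn[symmetric] B_nn[symmetric] k_def \<rho>_def by (simp add: abs_minus_commute)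
    then show ?thesis using \<rho> B0 by (simp add: ennreal_mult[symmetric] ennreal_le_iff)
  qed
  have Bn: "B n \<le> B 0 * (\<rho> ^ 2) ^ n" for n
  proof (induction n)
    case (Suc n)
    have "B (Suc n) \<le> \<rho> * (\<rho> * B n)" using BA[of n] mult_left_mono[OF AB[of n], of \<rho>] \<rho>(1) by linarith
    also have "\<dots> \<le> \<rho> ^ 2 * (B 0 * (\<rho> ^ 2) ^ n)"
      using Suc mult_left_mono[of "B n" _ "\<rho> ^ 2"] by (simp add: power2_eq_square mult.assoc)
    finally show ?case by (simp add: ac_simps)
  qed simp
  have An: "A n \<le> B 0 * (\<rho> ^ 2) ^ n" for n
  proof -
    have "A n \<le> 1 * B n" using AB[of n] mult_right_mono[OF _ B0[of n], of \<rho> 1] \<rho> by simp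
    then show ?thesis using Bn[of n] by simp
  qed
  show ?thesis
    using k \<rho> B0[of 0] An[unfolded A_def] Bn
    by - (rule exI[of _ k], rule exI[of _ \<rho>], rule exI[of _ "B 0"], simp add: B_def[symmetric])
qed

end

section \<open>The Schroedinger system\<close>

context lyapunov_cost
begin

lemma log_partition_tendsto:
  assumes g: "\<And>n. admissible N b c (g n)" and lim: "AE y in N. (\<lambda>n. g n y) \<longlonglongrightarrow> l y"
    and l: "admissible N b c l"
  shows "AE x in M. (\<lambda>n. log_partition N w (g n) x) \<longlonglongrightarrow> log_partition N w l x"
  using exp_w_le_MN log_partition_bounds[OF l] AE_space
proof eventually_elim
  case (elim x)
  note [measurable] = w_meas_N[OF elim(3)] admissible_measurable[OF g] admissible_measurable[OF l]
  have "(\<lambda>n. \<integral>y. exp (- w x y - g n y) \<partial>N) \<longlonglongrightarrow> (\<integral>y. exp (- w x y - l y) \<partial>N)"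
  proof (rule integral_dominated_convergence)
    show "integrable N (\<lambda>y. C * exp c * exp (b y))" using exp_b_int by simp
    show "AE y in N. (\<lambda>n. exp (- w x y - g n y)) \<longlonglongrightarrow> exp (- w x y - l y)"
      using lim by eventually_elim (auto intro!: tendsto_intros)
    show "AE y in N. norm (exp (- w x y - g n y)) \<le> C * exp c * exp (b y)" for n
      using elim(1) admissible_bounds[OF g[of n]]
    proof eventually_elim
      case (elim y)
      have "exp (- w x y) * exp (- g n y) \<le> C * exp (c + b y)"
        using elim C_ge_1 by (intro mult_mono) auto
      moreover have "exp (- w x y - g n y) = exp (- w x y) * exp (- g n y)"
        by (subst exp_add[symmetric]) simp
      ultimately show ?case by (simp add: exp_add mult.assoc)
    qed
  qed measurable
  moreover have "0 < (\<integral>y. exp (- w x y - l y) \<partial>N)" using elim(2) exp_gt_zero[of "log_partition N w l x"] by simp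
  ultimately show ?case unfolding log_partition_def by (intro tendsto_ln) auto
qed

lemma admissible_limit:
  assumes f: "\<And>n. admissible M a c (f n)" and l[measurable]: "l \<in> borel_measurable M"
    and lim: "AE x in M. (\<lambda>n. f n x) \<longlonglongrightarrow> l x"
  shows "admissible M a c l"
proof -
  have "AE x in M. \<forall>n. - a x - c \<le> f n x \<and> f n x \<le> c"
    unfolding AE_all_countable using admissible_bounds[OF f] by blast
  with lim have "AE x in M. - a x - c \<le> l x \<and> l x \<le> c"
  proof eventually_elim
    case (elim x)
    show ?case using LIMSEQ_le_const[OF elim(1), of "- a x - c"] LIMSEQ_le_const2[OF elim(1), of c] elim(2) by blast
  qed
  then show ?thesis by (simp add: admissible_def)
qed

lemma admissible_dominated:
  assumes "admissible M a c f" shows "AE x in M. \<bar>f x\<bar> \<le> \<bar>a x\<bar> + \<bar>c\<bar>"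
  using admissible_bounds[OF assms] by eventually_elim linarith

text \<open>The limits solve the Schroedinger system, because \<open>log_partition\<close> is continuous along dominated
  almost everywhere convergence.\<close>

lemma potentials_converge:
  "\<exists>fl gl \<rho> c. 0 < \<rho> \<and> \<rho> < 1 \<and> 0 \<le> c \<and> admissible M a potential_bound fl \<and> admissible N b potential_bound gl \<and>
    (AE x in M. fl x = log_partition N w gl x) \<and>
    (AE y in N. gl y = log_partition M (\<lambda>y x. w x y) fl y) \<and>
    (\<lambda>n. \<integral>x. pot_f n x \<partial>M) \<longlonglongrightarrow> (\<integral>x. fl x \<partial>M) \<and>
    (\<lambda>n. \<integral>y. pot_g n y \<partial>N) \<longlonglongrightarrow> (\<integral>y. gl y \<partial>N) \<and>
    (\<forall>n. \<bar>(\<integral>x. pot_f n x \<partial>M) - (\<integral>x. fl x \<partial>M)\<bar> \<le> c * (\<rho> ^ 2) ^ n) \<and>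
    (\<forall>n. \<bar>(\<integral>y. pot_g n y \<partial>N) - (\<integral>y. gl y \<partial>N)\<bar> \<le> c * (\<rho> ^ 2) ^ n)"
proof -
  obtain k \<rho> E where k: "0 < k" and \<rho>: "0 < \<rho>" "\<rho> < 1" and E: "0 \<le> E"
    and Ef: "\<And>n. (\<integral>x. \<bar>exp (pot_f (Suc n) x - pot_f n x) - 1\<bar> * (1 + k * \<phi> x) \<partial>M) \<le> E * (\<rho> ^ 2) ^ n"
    and Eg: "\<And>n. (\<integral>y. \<bar>exp (pot_g (Suc n) y - pot_g n y) - 1\<bar> * (1 + k * \<psi> y) \<partial>N) \<le> E * (\<rho> ^ 2) ^ n"
    using geometric_contraction by blast
  have q: "0 \<le> \<rho> ^ 2" "\<rho> ^ 2 < 1" using \<rho> power_strict_mono[of \<rho> 1 2] by simp_all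
  obtain L1 where L1: "0 \<le> L1" "\<And>f f'. admissible M a potential_bound f \<Longrightarrow> admissible M a potential_bound f' \<Longrightarrow>
      integrable M (\<lambda>x. exp (f' x - f x)) \<Longrightarrow> (\<integral>x. exp (f' x - f x) \<partial>M) = 1 \<Longrightarrow>
      (\<integral>x. \<bar>f x - f' x\<bar> \<partial>M) \<le> L1 * (\<integral>x. \<bar>exp (f' x - f x) - 1\<bar> * (1 + k * \<phi> x) \<partial>M)"
    using L1_le_weighted[OF k, of potential_bound] by blast
  obtain L2 where L2: "0 \<le> L2" "\<And>f f'. admissible N b potential_bound f \<Longrightarrow> admissible N b potential_bound f' \<Longrightarrow>
      integrable N (\<lambda>x. exp (f' x - f x)) \<Longrightarrow> (\<integral>x. exp (f' x - f x) \<partial>N) = 1 \<Longrightarrow>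
      (\<integral>x. \<bar>f x - f' x\<bar> \<partial>N) \<le> L2 * (\<integral>x. \<bar>exp (f' x - f x) - 1\<bar> * (1 + k * \<psi> x) \<partial>N)"
    using lyapunov_cost.L1_le_weighted[OF swap k, of potential_bound] by blast
  have df: "(\<integral>x. \<bar>pot_f n x - pot_f (Suc n) x\<bar> \<partial>M) \<le> L1 * E * (\<rho> ^ 2) ^ n" for n
    using L1(2)[OF pot_f_admissible[of n] pot_f_admissible[of "Suc n"]
      exp_diff_mean[OF pot_f_admissible pot_g_admissible pot_g.simps pot_f.simps(2)]]
      mult_left_mono[OF Ef[of n] L1(1)] by (simp add: mult.assoc)
  have dg: "(\<integral>x. \<bar>pot_g n x - pot_g (Suc n) x\<bar> \<partial>N) \<le> L2 * E * (\<rho> ^ 2) ^ n" for n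
    using L2(2)[OF pot_g_admissible[of n] pot_g_admissible[of "Suc n"]
      lyapunov_cost.exp_diff_mean[OF swap pot_g_admissible pot_f_admissible pot_f.simps(2) pot_g.simps]]
      mult_left_mono[OF Eg[of n] L2(1)] by (simp add: mult.assoc)
  obtain fl where fl: "fl \<in> borel_measurable M" "AE x in M. (\<lambda>n. pot_f n x) \<longlonglongrightarrow> fl x"
    "(\<lambda>n. \<integral>x. pot_f n x \<partial>M) \<longlonglongrightarrow> (\<integral>x. fl x \<partial>M)"
    "\<And>n. \<bar>(\<integral>x. pot_f n x \<partial>M) - (\<integral>x. fl x \<partial>M)\<bar> \<le> L1 * E / (1 - \<rho> ^ 2) * (\<rho> ^ 2) ^ n"
    using geometric_L1_limit[OF pot_f_int _ admissible_dominated[OF pot_f_admissible] df q] a_int by auto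
  obtain gl where gl: "gl \<in> borel_measurable N" "AE y in N. (\<lambda>n. pot_g n y) \<longlonglongrightarrow> gl y"
    "(\<lambda>n. \<integral>y. pot_g n y \<partial>N) \<longlonglongrightarrow> (\<integral>y. gl y \<partial>N)"
    "\<And>n. \<bar>(\<integral>y. pot_g n y \<partial>N) - (\<integral>y. gl y \<partial>N)\<bar> \<le> L2 * E / (1 - \<rho> ^ 2) * (\<rho> ^ 2) ^ n"
    using geometric_L1_limit[OF pot_g_int _ lyapunov_cost.admissible_dominated[OF swap pot_g_admissible] dg q] b_int by auto
  have adm: "admissible M a potential_bound fl" "admissible N b potential_bound gl"
    using admissible_limit[OF pot_f_admissible fl(1,2)]
      lyapunov_cost.admissible_limit[OF swap pot_g_admissible gl(1,2)] by auto
  have "AE x in M. (\<lambda>n. pot_f (Suc n) x) \<longlonglongrightarrow> log_partition N w gl x"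
    using log_partition_tendsto[OF pot_g_admissible gl(2) adm(2)] by (simp add: pot_f.simps(2))
  with fl(2) have fix_f: "AE x in M. fl x = log_partition N w gl x"
  proof eventually_elim
    case (elim x) show ?case by (rule LIMSEQ_unique[OF LIMSEQ_Suc[OF elim(1)] elim(2)])
  qed
  have "AE y in N. (\<lambda>n. pot_g n y) \<longlonglongrightarrow> log_partition M (\<lambda>y x. w x y) fl y"
    using lyapunov_cost.log_partition_tendsto[OF swap pot_f_admissible fl(2) adm(1)] by (simp add: pot_g.simps)
  with gl(2) have fix_g: "AE y in N. gl y = log_partition M (\<lambda>y x. w x y) fl y"
  proof eventually_elim
    case (elim x) show ?case by (rule LIMSEQ_unique[OF elim(1) elim(2)])
  qed
  define c where "c = L1 * E / (1 - \<rho> ^ 2) + L2 * E / (1 - \<rho> ^ 2)"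
  have c12: "0 \<le> L1 * E / (1 - \<rho> ^ 2)" "0 \<le> L2 * E / (1 - \<rho> ^ 2)" using L1 L2 E q by auto
  have le: "L1 * E / (1 - \<rho> ^ 2) * (\<rho> ^ 2) ^ n \<le> c * (\<rho> ^ 2) ^ n"
     "L2 * E / (1 - \<rho> ^ 2) * (\<rho> ^ 2) ^ n \<le> c * (\<rho> ^ 2) ^ n" for n
    using c12 q unfolding c_def by (rule_tac [!] mult_right_mono) simp_all
  have "0 \<le> c" using c12 by (simp add: c_def)
  then show ?thesis
    using \<rho> adm fix_f fix_g fl(3) gl(3) order_trans[OF fl(4) le(1)] order_trans[OF gl(4) le(2)]
    by - (rule exI[of _ fl], rule exI[of _ gl], rule exI[of _ \<rho>], rule exI[of _ c], simp)
qed

definition plan :: "('a \<Rightarrow> real) \<Rightarrow> ('b \<Rightarrow> real) \<Rightarrow> ('a \<times> 'b) measure" where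
  "plan f g = density (M \<Otimes>\<^sub>M N) (\<lambda>(x, y). ennreal (exp (- w x y - f x - g y)))"

end

section \<open>Entropy of the Schroedinger bridge\<close>

lemma distr_fst_density:
  assumes "sigma_finite_measure N" and k[measurable]: "k \<in> borel_measurable (M \<Otimes>\<^sub>M N)"
  shows "distr (density (M \<Otimes>\<^sub>M N) k) M fst = density M (\<lambda>x. \<integral>\<^sup>+y. k (x, y) \<partial>N)"
proof (rule measure_eqI)
  interpret N: sigma_finite_measure N by fact
  fix A assume "A \<in> sets (distr (density (M \<Otimes>\<^sub>M N) k) M fst)"
  then have A[measurable]: "A \<in> sets M" by simp
  have "emeasure (distr (density (M \<Otimes>\<^sub>M N) k) M fst) A
     = (\<integral>\<^sup>+z. k z * indicator (fst -` A \<inter> space (M \<Otimes>\<^sub>M N)) z \<partial>(M \<Otimes>\<^sub>M N))"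
    by (simp add: emeasure_distr emeasure_density)
  also have "\<dots> = (\<integral>\<^sup>+z. k z * indicator A (fst z) \<partial>(M \<Otimes>\<^sub>M N))"
    by (intro nn_integral_cong) (auto simp: indicator_def)
  also have "\<dots> = (\<integral>\<^sup>+x. \<integral>\<^sup>+y. k (x, y) * indicator A x \<partial>N \<partial>M)"
    by (subst N.nn_integral_fst[symmetric]) auto
  also have "\<dots> = (\<integral>\<^sup>+x. (\<integral>\<^sup>+y. k (x, y) \<partial>N) * indicator A x \<partial>M)"
    by (intro nn_integral_cong nn_integral_multc) measurable
  also have "\<dots> = emeasure (density M (\<lambda>x. \<integral>\<^sup>+y. k (x, y) \<partial>N)) A"
    by (simp add: emeasure_density)
  finally show "emeasure (distr (density (M \<Otimes>\<^sub>M N) k) M fst) A = emeasure (density M (\<lambda>x. \<integral>\<^sup>+y. k (x, y) \<partial>N)) A" .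
qed simp

lemma distr_snd_density:
  assumes "sigma_finite_measure M" "sigma_finite_measure N" and k[measurable]: "k \<in> borel_measurable (M \<Otimes>\<^sub>M N)"
  shows "distr (density (M \<Otimes>\<^sub>M N) k) N snd = density N (\<lambda>y. \<integral>\<^sup>+x. k (x, y) \<partial>M)"
proof (rule measure_eqI)
  interpret M: sigma_finite_measure M by fact
  interpret N: sigma_finite_measure N by fact
  interpret MN: pair_sigma_finite M N ..
  fix A assume "A \<in> sets (distr (density (M \<Otimes>\<^sub>M N) k) N snd)"
  then have A[measurable]: "A \<in> sets N" by simp
  have "emeasure (distr (density (M \<Otimes>\<^sub>M N) k) N snd) A
     = (\<integral>\<^sup>+z. k z * indicator (snd -` A \<inter> space (M \<Otimes>\<^sub>M N)) z \<partial>(M \<Otimes>\<^sub>M N))"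
    by (simp add: emeasure_distr emeasure_density)
  also have "\<dots> = (\<integral>\<^sup>+z. k z * indicator A (snd z) \<partial>(M \<Otimes>\<^sub>M N))"
    by (intro nn_integral_cong) (auto simp: indicator_def)
  also have "\<dots> = (\<integral>\<^sup>+y. \<integral>\<^sup>+x. k (x, y) * indicator A y \<partial>M \<partial>N)"
    by (subst MN.nn_integral_snd[symmetric]) auto
  also have "\<dots> = (\<integral>\<^sup>+y. (\<integral>\<^sup>+x. k (x, y) \<partial>M) * indicator A y \<partial>N)"
    by (intro nn_integral_cong nn_integral_multc) measurable
  also have "\<dots> = emeasure (density N (\<lambda>y. \<integral>\<^sup>+x. k (x, y) \<partial>M)) A"
    by (simp add: emeasure_density)
  finally show "emeasure (distr (density (M \<Otimes>\<^sub>M N) k) N snd) A = emeasure (density N (\<lambda>y. \<integral>\<^sup>+x. k (x, y) \<partial>M)) A" .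
qed simp

context lyapunov_cost
begin

definition coupling :: "('a \<times> 'b) measure \<Rightarrow> bool" where
  "coupling P \<longleftrightarrow> prob_space P \<and> sets P = sets (M \<Otimes>\<^sub>M N) \<and> distr P M fst = M \<and> distr P N snd = N"

lemma coupling_integral:
  fixes f :: "'a \<Rightarrow> real" and g :: "'b \<Rightarrow> real"
  assumes P: "coupling P" and f: "integrable M f" and g: "integrable N g"
  shows "integrable P (\<lambda>(x, y). f x + g y)" "(\<integral>z. (case z of (x, y) \<Rightarrow> f x + g y) \<partial>P) = (\<integral>x. f x \<partial>M) + (\<integral>y. g y \<partial>N)"
proof -
  have sets[measurable_cong]: "sets P = sets (M \<Otimes>\<^sub>M N)" and d: "distr P M fst = M" "distr P N snd = N"
    using P by (auto simp: coupling_def)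
  have fi: "integrable P (\<lambda>z. f (fst z))" "(\<integral>z. f (fst z) \<partial>P) = (\<integral>x. f x \<partial>M)"
    using integrable_distr[of fst P M f] integral_distr[of fst P M f] f unfolding d by (auto simp: measurable_cong_sets[OF sets refl])
  have gi: "integrable P (\<lambda>z. g (snd z))" "(\<integral>z. g (snd z) \<partial>P) = (\<integral>x. g x \<partial>N)"
    using integrable_distr[of snd P N g] integral_distr[of snd P N g] g unfolding d by (auto simp: measurable_cong_sets[OF sets refl])
  show "integrable P (\<lambda>(x, y). f x + g y)" "(\<integral>z. (case z of (x, y) \<Rightarrow> f x + g y) \<partial>P) = (\<integral>x. f x \<partial>M) + (\<integral>y. g y \<partial>N)"
    using fi gi by (simp_all add: case_prod_beta')
qed

text \<open>Under a coupling, the integral of \<open>f x + g y\<close> depends on the marginals only. Two plans therefore differ,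
  as reference measures for the entropy of couplings, by a constant.\<close>

lemma Ent_plan:
  assumes P: "coupling P" and base: "prob_space (plan f' g')"
    and f: "integrable M f" "integrable M f'" and g: "integrable N g" "integrable N g'"
  shows "Ent P (plan f g) = Ent P (plan f' g') + ereal ((\<integral>x. f x \<partial>M) - (\<integral>x. f' x \<partial>M) + ((\<integral>y. g y \<partial>N) - (\<integral>y. g' y \<partial>N)))"
proof -
  note [measurable] = borel_measurable_integrable[OF f(1)] borel_measurable_integrable[OF f(2)]
    borel_measurable_integrable[OF g(1)] borel_measurable_integrable[OF g(2)]
  let ?h = "\<lambda>(x, y). (f' x - f x) + (g' y - g y)"
  have e: "exp (- w x y - f x - g y) = exp (- w x y - f' x - g' y) * exp ((f' x - f x) + (g' y - g y))" for x y
    by (rule trans[OF arg_cong[of _ _ exp] exp_add]) simp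
  have "plan f g = density (plan f' g') (\<lambda>z. ennreal (exp (?h z)))"
    unfolding plan_def
    by (subst density_density_eq) (auto intro!: density_cong simp: e ennreal_mult)
  moreover have "Ent P (density (plan f' g') (\<lambda>z. ennreal (exp (?h z)))) = Ent P (plan f' g') - ereal (\<integral>z. ?h z \<partial>P)"
    using P coupling_integral(1)[OF P, of "\<lambda>x. f' x - f x" "\<lambda>y. g' y - g y"] f g
    by (intro Ent_density_exp base) (auto simp: coupling_def plan_def)
  moreover have "(\<integral>z. ?h z \<partial>P) = ((\<integral>x. f' x \<partial>M) - (\<integral>x. f x \<partial>M)) + ((\<integral>y. g' y \<partial>N) - (\<integral>y. g y \<partial>N))"
    using coupling_integral(2)[OF P, of "\<lambda>x. f' x - f x" "\<lambda>y. g' y - g y"] f g by simp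
  ultimately show ?thesis by (cases "Ent P (plan f' g')") auto
qed

lemma coupling_plan:
  assumes f: "admissible M a c f" "AE x in M. f x = log_partition N w g x"
    and g: "admissible N b c g" "AE y in N. g y = log_partition M (\<lambda>y x. w x y) f y"
  shows "coupling (plan f g)"
proof -
  note [measurable] = admissible_measurable[OF f(1)] admissible_measurable[OF g(1)]
  have km: "(\<lambda>(x, y). ennreal (exp (- w x y - f x - g y))) \<in> borel_measurable (M \<Otimes>\<^sub>M N)" by measurable
  have "AE x in M. (\<integral>\<^sup>+y. ennreal (exp (- w x y - f x - g y)) \<partial>N) = 1"
    using kernel_mass[OF g(1) refl] f(2) by eventually_elim simp
  then have 1: "distr (plan f g) M fst = M"
    unfolding plan_def distr_fst_density[OF N.sigma_finite_measure_axioms km] prod.case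
    by (subst density_cong[where f' = "\<lambda>_. 1"]) (auto simp: density_1)
  have "AE y in N. (\<integral>\<^sup>+x. ennreal (exp (- w x y - f x - g y)) \<partial>M) = 1"
    using lyapunov_cost.kernel_mass[OF swap f(1) refl] g(2) by eventually_elim (simp add: algebra_simps)
  then have 2: "distr (plan f g) N snd = N"
    unfolding plan_def distr_snd_density[OF M.sigma_finite_measure_axioms N.sigma_finite_measure_axioms km] prod.case
    by (subst density_cong[where f' = "\<lambda>_. 1"]) (auto simp: density_1)
  have "prob_space (distr (plan f g) M fst)" unfolding 1 by (rule M.prob_space_axioms)
  then have "prob_space (plan f g)"
    by (rule prob_space_distrD[rotated]) (simp add: plan_def)
  then show ?thesis using 1 2 by (simp add: coupling_def plan_def)
qed

text \<open>The limit plan \<open>Q\<close> is a coupling. By \<open>Ent_plan\<close> the entropy relative to the initial plan is the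
  entropy relative to \<open>Q\<close> plus a constant, so a minimiser \<open>PP\<close> has entropy 0 relative to \<open>Q\<close>. Its
  entropy relative to a Sinkhorn plan is then the distance of the means of the potentials from their
  limits. The decrements of these means are the entropies of the marginals, which gives the series, and
  the means converge geometrically, which gives the rate.\<close>

theorem sinkhorn_entropy:
  assumes g0: "integrable N g0"
    and PP: "PP = arg_min (\<lambda>P. Ent P (plan (\<lambda>_. 0) g0)) coupling"
  shows "(\<forall>m. Ent PP (plan (pot_f (Suc m)) (pot_g m)) =
       (\<Sum>p. Ent M (density M (\<lambda>x. ennreal (exp (pot_f (Suc (Suc m + p)) x - pot_f (Suc m + p) x))))) +
       (\<Sum>p. Ent N (density N (\<lambda>y. ennreal (exp (pot_g (Suc (m + p)) y - pot_g (m + p) y)))))) \<and>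
    (\<exists>\<rho> c. 0 \<le> \<rho> \<and> \<rho> < 1 \<and> 0 < c \<and>
      (\<forall>m. Ent PP (plan (pot_f (Suc m)) (pot_g m)) \<le> ereal (c * \<rho> ^ (2 * Suc m))))"
proof -
  obtain fl gl \<rho> c where \<rho>: "0 < \<rho>" "\<rho> < 1" and c: "0 \<le> c"
    and fl: "admissible M a potential_bound fl" "AE x in M. fl x = log_partition N w gl x"
    and gl: "admissible N b potential_bound gl" "AE y in N. gl y = log_partition M (\<lambda>y x. w x y) fl y"
    and lim: "(\<lambda>n. \<integral>x. pot_f n x \<partial>M) \<longlonglongrightarrow> (\<integral>x. fl x \<partial>M)" "(\<lambda>n. \<integral>y. pot_g n y \<partial>N) \<longlonglongrightarrow> (\<integral>y. gl y \<partial>N)"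
    and rate_f: "\<And>n. \<bar>(\<integral>x. pot_f n x \<partial>M) - (\<integral>x. fl x \<partial>M)\<bar> \<le> c * (\<rho> ^ 2) ^ n"
    and rate_g: "\<And>n. \<bar>(\<integral>y. pot_g n y \<partial>N) - (\<integral>y. gl y \<partial>N)\<bar> \<le> c * (\<rho> ^ 2) ^ n"
    using potentials_converge by blast
  note fl_int = admissible_int[OF fl(1)] and gl_int = admissible_N_int[OF gl(1)]
  define Q where "Q = plan fl gl"
  have Q: "coupling Q" unfolding Q_def by (rule coupling_plan[OF fl gl])
  then have Qp: "prob_space Q" by (simp add: coupling_def)
  have EQ: "Ent P (plan f g) = Ent P Q + ereal ((\<integral>x. f x \<partial>M) - (\<integral>x. fl x \<partial>M) + ((\<integral>y. g y \<partial>N) - (\<integral>y. gl y \<partial>N)))"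
    if "coupling P" "integrable M f" "integrable N g" for P f g
    unfolding Q_def by (rule Ent_plan[OF that(1) Qp[unfolded Q_def] that(2) fl_int that(3) gl_int])
  have nonneg: "0 \<le> Ent P Q" if "coupling P" for P
    using that Q by (intro Ent_nonneg Qp) (auto simp: coupling_def)
  define \<kappa> where "\<kappa> = (\<integral>x. 0 \<partial>M) - (\<integral>x. fl x \<partial>M) + ((\<integral>y. g0 y \<partial>N) - (\<integral>y. gl y \<partial>N))"
  have E0: "Ent P (plan (\<lambda>_. 0) g0) = Ent P Q + ereal \<kappa>" if "coupling P" for P
    unfolding \<kappa>_def by (rule EQ[OF that _ g0]) simp
  have Q0: "Ent Q Q = 0" by (rule Ent_self[OF Qp])
  have "is_arg_min (\<lambda>P. Ent P (plan (\<lambda>_. 0) g0)) coupling Q"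
    unfolding is_arg_min_def
  proof (intro conjI notI)
    assume "\<exists>P. coupling P \<and> Ent P (plan (\<lambda>_. 0) g0) < Ent Q (plan (\<lambda>_. 0) g0)"
    then obtain P where P: "coupling P" "Ent P Q + ereal \<kappa> < 0 + ereal \<kappa>"
      using E0 Q Q0 by metis
    then show False using nonneg[OF P(1)] by (cases "Ent P Q") auto
  qed (rule Q)
  then have "is_arg_min (\<lambda>P. Ent P (plan (\<lambda>_. 0) g0)) coupling PP"
    unfolding PP arg_min_def by (rule someI)
  then have PPc: "coupling PP" and "\<not> Ent Q (plan (\<lambda>_. 0) g0) < Ent PP (plan (\<lambda>_. 0) g0)"
    using Q by (auto simp: is_arg_min_def)
  then have "Ent PP Q + ereal \<kappa> \<le> 0 + ereal \<kappa>" using E0 Q Q0 by (simp add: not_less)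
  then have PPQ: "Ent PP Q = 0" using nonneg[OF PPc] by (cases "Ent PP Q") auto
  have Ent_PP: "Ent PP (plan (pot_f n) (pot_g m)) =
     ereal ((\<integral>x. pot_f n x \<partial>M) - (\<integral>x. fl x \<partial>M)) + ereal ((\<integral>y. pot_g m y \<partial>N) - (\<integral>y. gl y \<partial>N))" for n m
    using EQ[OF PPc pot_f_int pot_g_int] PPQ by simp
  have sum_f: "(\<Sum>p. Ent M (density M (\<lambda>x. ennreal (exp (pot_f (Suc (n + p)) x - pot_f (n + p) x)))))
      = ereal ((\<integral>x. pot_f n x \<partial>M) - (\<integral>x. fl x \<partial>M))" for n
  proof -
    have "Ent M (density M (\<lambda>x. ennreal (exp (pot_f (Suc (n + p)) x - pot_f (n + p) x))))
        = ereal ((\<integral>x. pot_f (n + p) x \<partial>M) - (\<integral>x. pot_f (n + Suc p) x \<partial>M))" for p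
      by (subst Ent_density_exp_self[OF M.prob_space_axioms]) (auto simp: pot_f_int)
    moreover have "(\<lambda>p. (\<integral>x. pot_f (n + p) x \<partial>M) - (\<integral>x. pot_f (n + Suc p) x \<partial>M)) sums ((\<integral>x. pot_f (n + 0) x \<partial>M) - (\<integral>x. fl x \<partial>M))"
      using LIMSEQ_ignore_initial_segment[OF lim(1), of n] by (intro telescope_sums') (simp add: add.commute)
    ultimately show ?thesis by (simp add: sums_unique[symmetric] flip: sums_ereal)
  qed
  have sum_g: "(\<Sum>p. Ent N (density N (\<lambda>x. ennreal (exp (pot_g (Suc (n + p)) x - pot_g (n + p) x)))))
      = ereal ((\<integral>x. pot_g n x \<partial>N) - (\<integral>x. gl x \<partial>N))" for n
  proof -
    have "Ent N (density N (\<lambda>x. ennreal (exp (pot_g (Suc (n + p)) x - pot_g (n + p) x))))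
        = ereal ((\<integral>x. pot_g (n + p) x \<partial>N) - (\<integral>x. pot_g (n + Suc p) x \<partial>N))" for p
      by (subst Ent_density_exp_self[OF N.prob_space_axioms]) (auto simp: pot_g_int)
    moreover have "(\<lambda>p. (\<integral>x. pot_g (n + p) x \<partial>N) - (\<integral>x. pot_g (n + Suc p) x \<partial>N)) sums ((\<integral>x. pot_g (n + 0) x \<partial>N) - (\<integral>x. gl x \<partial>N))"
      using LIMSEQ_ignore_initial_segment[OF lim(2), of n] by (intro telescope_sums') (simp add: add.commute)
    ultimately show ?thesis by (simp add: sums_unique[symmetric] flip: sums_ereal)
  qed
  \<comment> \<open>The factor \<open>1 / \<rho> ^ 2\<close> pays for the index shift between \<open>pot_f (Suc m)\<close> and \<open>pot_g m\<close>.\<close>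
  define c' where "c' = (c + 1) * (1 + 1 / \<rho> ^ 2)"
  have c': "0 < c'" using c \<rho> by (simp add: c'_def add_pos_pos)
  have bnd: "Ent PP (plan (pot_f (Suc m)) (pot_g m)) \<le> ereal (c' * \<rho> ^ (2 * Suc m))" for m
  proof -
    have "(\<integral>x. pot_f (Suc m) x \<partial>M) - (\<integral>x. fl x \<partial>M) + ((\<integral>y. pot_g m y \<partial>N) - (\<integral>y. gl y \<partial>N))
       \<le> c * (\<rho> ^ 2) ^ Suc m + c * (\<rho> ^ 2) ^ m"
      using rate_f[of "Suc m"] rate_g[of m] by linarith
    also have "\<dots> = c * (1 + 1 / \<rho> ^ 2) * (\<rho> ^ 2) ^ Suc m"
      using \<rho> by (simp add: field_simps)
    also have "\<dots> \<le> c' * (\<rho> ^ 2) ^ Suc m"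
      unfolding c'_def using c \<rho> by (intro mult_right_mono) auto
    finally show ?thesis by (simp only: Ent_PP power_mult plus_ereal.simps ereal_less_eq)
  qed
  have "\<forall>m. Ent PP (plan (pot_f (Suc m)) (pot_g m)) =
       (\<Sum>p. Ent M (density M (\<lambda>x. ennreal (exp (pot_f (Suc (Suc m + p)) x - pot_f (Suc m + p) x))))) +
       (\<Sum>p. Ent N (density N (\<lambda>y. ennreal (exp (pot_g (Suc (m + p)) y - pot_g (m + p) y)))))"
    unfolding sum_f sum_g Ent_PP by simp
  then show ?thesis
    using bnd c' \<rho> by - (rule conjI, assumption, rule exI[of _ \<rho>], rule exI[of _ c'], simp)
qed

end

section \<open>Gibbs measures and their kernels\<close>

lemma sets_gibbs[simp, measurable_cong]: "sets (gibbs \<mu> F) = sets \<mu>"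
  by (simp add: gibbs_def)

lemma space_gibbs[simp]: "space (gibbs \<mu> F) = space \<mu>"
  by (simp add: gibbs_def)

lemma gibbs_reweight:
  assumes [measurable]: "F \<in> borel_measurable \<mu>" "G \<in> borel_measurable \<mu>"
  shows "gibbs \<mu> F = density (gibbs \<mu> G) (\<lambda>x. ennreal (exp (G x - F x)))"
  unfolding gibbs_def
  by (subst density_density_eq) (auto intro!: density_cong simp: ennreal_mult'[symmetric] exp_add[symmetric])

lemma nn_integral_gibbs_reweight:
  fixes h :: "'a \<Rightarrow> real"
  assumes [measurable]: "F \<in> borel_measurable \<mu>" "G \<in> borel_measurable \<mu>" "h \<in> borel_measurable \<mu>"
  shows "(\<integral>\<^sup>+x. ennreal (h x) \<partial>gibbs \<mu> F) = (\<integral>\<^sup>+x. ennreal (h x * exp (G x - F x)) \<partial>gibbs \<mu> G)"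
  unfolding gibbs_reweight[OF assms(1,2)]
  by (subst nn_integral_density) (auto simp: ennreal_mult'' mult.commute)

lemma sigma_finite_of_gibbs:
  assumes "prob_space (gibbs \<mu> F)" and [measurable]: "F \<in> borel_measurable \<mu>"
  shows "sigma_finite_measure \<mu>"
proof -
  interpret prob_space "gibbs \<mu> F" by fact
  have "sigma_finite_measure (density (gibbs \<mu> F) (\<lambda>x. ennreal (exp (F x))))"
    by (subst sigma_finite_iff_density_finite) auto
  also have "density (gibbs \<mu> F) (\<lambda>x. ennreal (exp (F x))) = \<mu>"
    unfolding gibbs_def
    by (subst density_density_eq) (auto simp: ennreal_mult'[symmetric] exp_add[symmetric] density_1)
  finally show ?thesis .
qed

lemma gibbs_integral_exp:
  assumes [measurable]: "w \<in> borel_measurable \<mu>" "F \<in> borel_measurable \<mu>" "f \<in> borel_measurable \<mu>"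
  shows "(\<integral>x. exp (- (F x + f x)) \<partial>gibbs \<mu> w) = (\<integral>x. exp (- w x - f x) \<partial>gibbs \<mu> F)"
  unfolding gibbs_def
  by (simp add: integral_density exp_add[symmetric] algebra_simps)

text \<open>Passing from \<open>\<nu>\<close> to the probability measure \<open>gibbs \<nu> F\<close> absorbs the summand \<open>F\<close> of the potential, so the
  normalised kernels of the iteration involve only the reduced potential \<open>g\<close>.\<close>

lemma normalized_kernel_density:
  assumes K: "K x = gibbs \<nu> w"
    and [measurable]: "w \<in> borel_measurable \<nu>" "F \<in> borel_measurable \<nu>" "g \<in> borel_measurable \<nu>"
  shows "normalized_kernel K (\<lambda>y. exp (- (F y + g y))) x =
    density (gibbs \<nu> F) (\<lambda>y. ennreal (exp (- w y - g y) / (\<integral>y. exp (- w y - g y) \<partial>gibbs \<nu> F)))"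
proof -
  let ?I = "\<integral>y. exp (- w y - g y) \<partial>gibbs \<nu> F"
  have I: "kernel_apply K (\<lambda>y. exp (- (F y + g y))) x = ?I"
    unfolding kernel_apply_def K by (rule gibbs_integral_exp) measurable
  have I0: "0 \<le> ?I" by simp
  have e: "ennreal (exp (- w y)) * ennreal (exp (- F y - g y) / ?I) = ennreal (exp (- F y)) * ennreal (exp (- w y - g y) / ?I)" for y
  proof -
    have "exp (- w y) * exp (- F y - g y) = exp (- F y) * exp (- w y - g y)"
      by (simp add: exp_add[symmetric])
    then have "exp (- w y) * (exp (- F y - g y) / ?I) = exp (- F y) * (exp (- w y - g y) / ?I)" by simp
    then show ?thesis using I0 by (simp add: ennreal_mult'[symmetric] del: times_divide_eq_right)
  qed
  show ?thesis
    unfolding normalized_kernel_def I unfolding K gibbs_def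
    by (subst (1 2) density_density_eq) (auto intro!: density_cong simp: e[unfolded gibbs_def])
qed

text \<open>If \<open>h\<close> is not integrable, its integral and hence the density is 0. So the normalised kernels are
  sub-probability measures at every point, as is required for the monadic bind, even where the
  normalising integral diverges.\<close>

lemma subprob_space_normalized_density:
  fixes h :: "'a \<Rightarrow> real"
  assumes "prob_space M" and h[measurable]: "h \<in> borel_measurable M" and h0: "\<And>x. 0 \<le> h x"
  shows "subprob_space (density M (\<lambda>x. ennreal (h x / (\<integral>x. h x \<partial>M))))"
proof
  interpret prob_space M by fact
  let ?I = "\<integral>x. h x \<partial>M"
  have "emeasure (density M (\<lambda>x. ennreal (h x / ?I))) (space M) = (\<integral>\<^sup>+x. ennreal (h x / ?I) \<partial>M)"
    by (simp add: emeasure_density cong: nn_integral_cong_simp)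
  also have "\<dots> \<le> 1"
  proof (cases "integrable M h")
    case True
    then have "(\<integral>\<^sup>+x. ennreal (h x / ?I) \<partial>M) = ennreal (\<integral>x. h x / ?I \<partial>M)"
      using h0 by (intro nn_integral_eq_integral) auto
    then show ?thesis by (auto simp: divide_self_if)
  next
    case False
    then show ?thesis by (simp add: not_integrable_integral_eq)
  qed
  finally show "emeasure (density M (\<lambda>x. ennreal (h x / ?I))) (space (density M (\<lambda>x. ennreal (h x / ?I)))) \<le> 1" by simp
  show "space (density M (\<lambda>x. ennreal (h x / ?I))) \<noteq> {}" using not_empty by simp
qed

lemma
  fixes \<mu> :: "'a::topological_space measure" and \<eta> :: "'b::topological_space measure"
  assumes "prob_space \<mu>" "prob_space \<eta>" and sets[measurable_cong]: "sets \<mu> = sets borel" "sets \<eta> = sets borel"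
    and k[measurable]: "k \<in> borel_measurable (borel \<Otimes>\<^sub>M borel)"
    and K: "\<And>x. K x = density \<eta> (\<lambda>y. k (x, y))" and sub: "\<And>x. subprob_space (K x)"
  shows joint_density: "joint \<mu> K = density (\<mu> \<Otimes>\<^sub>M \<eta>) k"
    and bind_density_kernel: "\<mu> \<bind> K = density \<eta> (\<lambda>y. \<integral>\<^sup>+x. k (x, y) \<partial>\<mu>)"
proof -
  interpret \<mu>: prob_space \<mu> by fact
  interpret \<eta>: prob_space \<eta> by fact
  interpret pair_prob_space \<mu> \<eta> ..
  have [simp]: "space \<mu> = UNIV" "space \<eta> = UNIV" using sets by (auto dest!: sets_eq_imp_space_eq)
  have ps[measurable_cong]: "sets (\<mu> \<Otimes>\<^sub>M \<eta>) = sets (borel \<Otimes>\<^sub>M borel)" by (intro sets_pair_measure_cong sets)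
  have K_meas: "K \<in> \<mu> \<rightarrow>\<^sub>M subprob_algebra borel"
  proof (rule measurable_subprob_algebra)
    fix A :: "'b set" assume A[measurable]: "A \<in> sets borel"
    have "emeasure (K x) A = (\<integral>\<^sup>+y. k (x, y) * indicator A y \<partial>\<eta>)" for x
      unfolding K by (rule emeasure_density) (auto simp: sets)
    then show "(\<lambda>x. emeasure (K x) A) \<in> borel_measurable \<mu>" by simp
  qed (use sub in \<open>auto simp: K sets\<close>)
  have J_meas: "(\<lambda>x. distr (K x) (borel \<Otimes>\<^sub>M borel) (Pair x)) \<in> \<mu> \<rightarrow>\<^sub>M subprob_algebra (borel \<Otimes>\<^sub>M borel)"
    by (rule measurable_distr2[OF _ K_meas]) measurable
  show "joint \<mu> K = density (\<mu> \<Otimes>\<^sub>M \<eta>) k"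
  proof (rule measure_eqI)
    show s: "sets (joint \<mu> K) = sets (density (\<mu> \<Otimes>\<^sub>M \<eta>) k)"
      unfolding joint_def using sets_bind[OF sets_kernel[OF J_meas]] ps by simp
    fix A assume "A \<in> sets (joint \<mu> K)"
    then have A[measurable]: "A \<in> sets (borel \<Otimes>\<^sub>M borel)" using s ps by simp
    have "emeasure (joint \<mu> K) A = (\<integral>\<^sup>+x. emeasure (distr (K x) (borel \<Otimes>\<^sub>M borel) (Pair x)) A \<partial>\<mu>)"
      unfolding joint_def by (rule emeasure_bind[OF _ J_meas]) auto
    also have "\<dots> = (\<integral>\<^sup>+x. \<integral>\<^sup>+y. k (x, y) * indicator A (x, y) \<partial>\<eta> \<partial>\<mu>)"
    proof (rule nn_integral_cong)
      fix x
      have "emeasure (distr (K x) (borel \<Otimes>\<^sub>M borel) (Pair x)) A = emeasure (K x) (Pair x -` A)"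
        by (subst emeasure_distr) (auto simp: K sets)
      also have "\<dots> = (\<integral>\<^sup>+y. k (x, y) * indicator (Pair x -` A) y \<partial>\<eta>)"
        unfolding K by (rule emeasure_density) (auto simp: sets intro: sets_Pair1[OF A])
      finally show "emeasure (distr (K x) (borel \<Otimes>\<^sub>M borel) (Pair x)) A = (\<integral>\<^sup>+y. k (x, y) * indicator A (x, y) \<partial>\<eta>)"
        by (simp add: indicator_def vimage_def)
    qed
    also have "\<dots> = (\<integral>\<^sup>+z. k z * indicator A z \<partial>(\<mu> \<Otimes>\<^sub>M \<eta>))"
      by (rule \<eta>.nn_integral_fst) measurable
    also have "\<dots> = emeasure (density (\<mu> \<Otimes>\<^sub>M \<eta>) k) A"
      by (rule emeasure_density[symmetric]) (auto simp: ps)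
    finally show "emeasure (joint \<mu> K) A = emeasure (density (\<mu> \<Otimes>\<^sub>M \<eta>) k) A" .
  qed
  show "\<mu> \<bind> K = density \<eta> (\<lambda>y. \<integral>\<^sup>+x. k (x, y) \<partial>\<mu>)"
  proof (rule measure_eqI)
    show s: "sets (\<mu> \<bind> K) = sets (density \<eta> (\<lambda>y. \<integral>\<^sup>+x. k (x, y) \<partial>\<mu>))"
      by (subst sets_bind[where N = borel]) (auto simp: K sets)
    fix A assume "A \<in> sets (\<mu> \<bind> K)"
    then have A[measurable]: "A \<in> sets borel" using s sets by simp
    have "emeasure (\<mu> \<bind> K) A = (\<integral>\<^sup>+x. emeasure (K x) A \<partial>\<mu>)"
      by (rule emeasure_bind[OF _ K_meas]) auto
    also have "\<dots> = (\<integral>\<^sup>+x. \<integral>\<^sup>+y. k (x, y) * indicator A y \<partial>\<eta> \<partial>\<mu>)"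
      unfolding K by (intro nn_integral_cong emeasure_density) (auto simp: sets)
    also have "\<dots> = (\<integral>\<^sup>+y. \<integral>\<^sup>+x. k (x, y) * indicator A y \<partial>\<mu> \<partial>\<eta>)"
      by (rule Fubini'[symmetric]) measurable
    also have "\<dots> = (\<integral>\<^sup>+y. (\<integral>\<^sup>+x. k (x, y) \<partial>\<mu>) * indicator A y \<partial>\<eta>)"
      by (intro nn_integral_cong nn_integral_multc) measurable
    also have "\<dots> = emeasure (density \<eta> (\<lambda>y. \<integral>\<^sup>+x. k (x, y) \<partial>\<mu>)) A"
      by (rule emeasure_density[symmetric]) (auto simp: sets)
    finally show "emeasure (\<mu> \<bind> K) A = emeasure (density \<eta> (\<lambda>y. \<integral>\<^sup>+x. k (x, y) \<partial>\<mu>)) A" .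
  qed
qed

text \<open>Outside the compact set where \<open>\<delta> * U - a \<le> - ln \<epsilon>\<close> the first summand on the right suffices, and on that
  set \<open>a\<close> is bounded.\<close>

lemma lyapunov_growth:
  fixes U a :: "'a::topological_space \<Rightarrow> real"
  assumes U: "locally_bounded U" and T: "locally_bounded (\<lambda>x. \<delta> * U x - a x)" "compact_sublevels (\<lambda>x. \<delta> * U x - a x)"
    and \<delta>: "0 \<le> \<delta>" and \<epsilon>: "0 < \<epsilon>"
  shows "\<exists>K. \<forall>x. exp (a x) \<le> \<epsilon> * exp (\<delta> * U x) + K"
proof -
  define S where "S = {x. \<delta> * U x - a x \<le> - ln \<epsilon>}"
  have "compact S" using T(2) by (simp add: S_def compact_sublevels_def)
  then have "bounded (U ` S)" "bounded ((\<lambda>x. \<delta> * U x - a x) ` S)"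
    using U T(1) by (auto simp: locally_bounded_def)
  then obtain B1 B2 where B: "\<And>x. x \<in> S \<Longrightarrow> \<bar>U x\<bar> \<le> B1" "\<And>x. x \<in> S \<Longrightarrow> \<bar>\<delta> * U x - a x\<bar> \<le> B2"
    by (auto simp: bounded_real)
  have "exp (a x) \<le> \<epsilon> * exp (\<delta> * U x) + exp (\<delta> * B1 + B2)" for x
  proof (cases "x \<in> S")
    case True
    have "\<delta> * U x \<le> \<delta> * B1" using B(1)[OF True] \<delta> by (intro mult_left_mono) auto
    then have "exp (a x) \<le> exp (\<delta> * B1 + B2)" using B(2)[OF True] by simp
    moreover have "0 \<le> \<epsilon> * exp (\<delta> * U x)" using \<epsilon> by simp
    ultimately show ?thesis by linarith
  next
    case False
    then have "exp (a x) \<le> exp (ln \<epsilon> + \<delta> * U x)" by (simp add: S_def)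
    also have "\<dots> = \<epsilon> * exp (\<delta> * U x)" using \<epsilon> by (simp add: exp_add)
    also have "\<dots> \<le> \<epsilon> * exp (\<delta> * U x) + exp (\<delta> * B1 + B2)" by simp
    finally show ?thesis .
  qed
  then show ?thesis by blast
qed

lemma compact_exp_sublevel:
  assumes "compact_sublevels U" "0 < \<delta>" shows "compact {x. exp (\<delta> * U x) \<le> R}"
proof (cases "0 < R")
  case True
  then have "{x. exp (\<delta> * U x) \<le> R} = {x. U x \<le> ln R / \<delta>}"
    using assms(2) by (auto simp: ln_ge_iff[symmetric] field_simps)
  then show ?thesis using assms(1) by (simp add: compact_sublevels_def)
next
  case False
  have "\<not> exp (\<delta> * U x) \<le> R" for x using False exp_gt_zero[of "\<delta> * U x"] by linarith
  then have "{x. exp (\<delta> * U x) \<le> R} = {}" by simp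
  then show ?thesis by simp
qed

lemma bounded_on_exp_sublevels:
  fixes U :: "'a::topological_space \<Rightarrow> real" and V :: "'b::topological_space \<Rightarrow> real"
  assumes "compact_sublevels U" "compact_sublevels V" "locally_bounded W" "0 < \<delta>"
  shows "\<exists>\<omega>. \<forall>x y. exp (\<delta> * U x) \<le> R \<longrightarrow> exp (\<delta> * V y) \<le> R \<longrightarrow> W (x, y) \<le> \<omega>"
proof -
  have "compact ({x. exp (\<delta> * U x) \<le> R} \<times> {y. exp (\<delta> * V y) \<le> R})"
    using assms by (intro compact_Times compact_exp_sublevel)
  then have "bounded (W ` ({x. exp (\<delta> * U x) \<le> R} \<times> {y. exp (\<delta> * V y) \<le> R}))"
    using assms(3) by (simp add: locally_bounded_def)
  then obtain B where "\<forall>z\<in>{x. exp (\<delta> * U x) \<le> R} \<times> {y. exp (\<delta> * V y) \<le> R}. \<bar>W z\<bar> \<le> B"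
    by (auto simp: bounded_real)
  then show ?thesis by (intro exI[of _ B]) force
qed

lemma compact_sublevels_bounded_below:
  assumes "compact_sublevels V" "locally_bounded V"
  shows "\<exists>v. \<forall>y. v \<le> V y"
proof -
  have "compact {y. V y \<le> 0}" using assms(1) by (simp add: compact_sublevels_def)
  then have "bounded (V ` {y. V y \<le> 0})" using assms(2) by (simp add: locally_bounded_def)
  then obtain B where B: "\<And>y. V y \<le> 0 \<Longrightarrow> \<bar>V y\<bar> \<le> B" by (auto simp: bounded_real)
  have "- \<bar>B\<bar> \<le> V y" for y
    using B[of y] by (cases "V y \<le> 0") auto
  then show ?thesis by blast
qed

section \<open>Sinkhorn iterations for Gibbs measures\<close>

theorem corollary4p15:
  fixes lam :: "'a::polish_space measure" and nu :: "'b::polish_space measure"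
    and U :: "'a \<Rightarrow> real" and V :: "'b \<Rightarrow> real" and W :: "'a \<times> 'b \<Rightarrow> real"
    and \<delta> :: real
    and P0 PP :: "('a \<times> 'b) measure"
    and \<phi> :: "'a \<Rightarrow> real" and \<psi> :: "'b \<Rightarrow> real"
  assumes "locally_compact_space (euclidean :: 'a topology)"
    and "locally_compact_space (euclidean :: 'b topology)"
    and "sets lam = sets borel" and "sets nu = sets borel"
    and "\<And>K. compact K \<Longrightarrow> emeasure lam K < \<infinity>"
    and "\<And>K. compact K \<Longrightarrow> emeasure nu K < \<infinity>"
    and "U \<in> borel_measurable borel" and "V \<in> borel_measurable borel"
    and "W \<in> borel_measurable (borel \<Otimes>\<^sub>M borel)"
    and "prob_space (gibbs lam U)" and "prob_space (gibbs nu V)"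
    and "kernel_Q nu W \<in> borel \<rightarrow>\<^sub>M prob_algebra borel"
    and "P0 = joint (gibbs lam U) (kernel_Q nu W)"
    and "\<exists>P \<in> couplings (gibbs lam U) (gibbs nu V). Ent P P0 < \<infinity>"
    and "PP = schroedinger_bridge (gibbs lam U) (gibbs nu V) P0"
    and "locally_bounded U" and "locally_bounded V" and "locally_bounded W"
    and "\<exists>C. AE z in lam \<Otimes>\<^sub>M nu. exp (- W z) \<le> C"
    and "compact_sublevels U" and "compact_sublevels V"
    and "0 < \<delta>" and "\<delta> \<le> 1"
    and "H_cond lam nu W \<delta> U V"
    and "\<phi> = (\<lambda>x. exp (\<delta> * (U x - (INF x. U x))))"
    and "\<psi> = (\<lambda>y. exp (\<delta> * (V y - (INF y. V y))))"
  shows "(\<forall>n\<ge>1. Ent PP (sinkhorn_P_even lam nu U V W n) =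
            (\<Sum>p. Ent (gibbs lam U) (sinkhorn_pi_odd lam nu U V W (n + p))) +
            (\<Sum>p. Ent (gibbs nu V) (sinkhorn_pi_even lam nu U V W (n + p)))) \<and>
         (\<exists>\<rho> c. 0 \<le> \<rho> \<and> \<rho> < 1 \<and> 0 < c \<and>
            (\<forall>n\<ge>1. Ent PP (sinkhorn_P_even lam nu U V W n) \<le>
               ereal (c * \<rho> ^ (2 * n) * ((\<integral>x. \<phi> x \<partial>gibbs lam U) + (\<integral>y. \<psi> y \<partial>gibbs nu V)))))"
proof -
  define \<mu> where "\<mu> = gibbs lam U"
  define \<eta> where "\<eta> = gibbs nu V"
  define w where "w x y = W (x, y)" for x y
  note sets_lam[measurable_cong] = assms(3) and sets_nu[measurable_cong] = assms(4)
  note [measurable] = assms(7-9)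
  have [simp]: "space lam = UNIV" "space nu = UNIV"
    using assms(3,4) by (auto dest!: sets_eq_imp_space_eq)
  have sets_\<mu>[measurable_cong]: "sets \<mu> = sets borel" and sets_\<eta>[measurable_cong]: "sets \<eta> = sets borel"
    using assms(3,4) by (simp_all add: \<mu>_def \<eta>_def)
  have [simp]: "space \<mu> = UNIV" "space \<eta> = UNIV" by (simp_all add: \<mu>_def \<eta>_def)
  interpret \<mu>: prob_space \<mu> unfolding \<mu>_def by fact
  interpret \<eta>: prob_space \<eta> unfolding \<eta>_def by fact
  have Wx[measurable]: "(\<lambda>y. W (x, y)) \<in> borel_measurable borel" for x by measurable
  have Wy[measurable]: "(\<lambda>x. W (x, y)) \<in> borel_measurable borel" for y by measurable
  have cost: "cost_V nu V W x = (\<integral>y. w x y \<partial>\<eta>)" "cost_U lam U W y = (\<integral>x. w x y \<partial>\<mu>)" for x y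
    by (simp_all add: cost_V_def cost_U_def w_def \<mu>_def \<eta>_def)
  note H = assms(24)[unfolded H_cond_def cost]
  obtain C0 where C0: "AE z in lam \<Otimes>\<^sub>M nu. exp (- W z) \<le> C0" using assms(19) by blast
  define C where "C = max C0 1"
  have lyap_nn: "(\<integral>\<^sup>+x. ennreal (exp (\<integral>y. w x y \<partial>\<eta>)) \<partial>gibbs lam (\<lambda>x. (1 - \<delta>) * U x)) < \<infinity>"
    "(\<integral>\<^sup>+y. ennreal (exp (\<integral>x. w x y \<partial>\<mu>)) \<partial>gibbs nu (\<lambda>y. (1 - \<delta>) * V y)) < \<infinity>"
    using H by auto
  have w_meas[measurable]: "(\<lambda>(x, y). w x y) \<in> borel_measurable (\<mu> \<Otimes>\<^sub>M \<eta>)" unfolding w_def by simp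
  have w_meas'[measurable]: "(\<lambda>(y, x). w x y) \<in> borel_measurable (\<eta> \<Otimes>\<^sub>M \<mu>)" unfolding w_def by measurable
  have AE_w: "AE z in \<mu> \<Otimes>\<^sub>M \<eta>. exp (- w (fst z) (snd z)) \<le> C"
  proof -
    have "\<mu> \<Otimes>\<^sub>M \<eta> = density (lam \<Otimes>\<^sub>M nu) (\<lambda>(x, y). ennreal (exp (- U x)) * ennreal (exp (- V y)))"
      unfolding \<mu>_def \<eta>_def gibbs_def
      using sigma_finite_of_gibbs[OF assms(11)] \<eta>.sigma_finite_measure_axioms
      by (intro pair_measure_density) (auto simp: \<eta>_def gibbs_def)
    moreover have "AE z in density (lam \<Otimes>\<^sub>M nu) (\<lambda>(x, y). ennreal (exp (- U x)) * ennreal (exp (- V y))). exp (- W z) \<le> C"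
      using C0 by (subst AE_density) (auto elim!: eventually_mono simp: C_def)
    ultimately show ?thesis by (simp only: w_def prod.collapse)
  qed
  have lyap: "integrable \<mu> (\<lambda>x. exp (\<integral>y. w x y \<partial>\<eta>) * exp (\<delta> * U x))"
    "integrable \<eta> (\<lambda>y. exp (\<integral>x. w x y \<partial>\<mu>) * exp (\<delta> * V y))"
  proof -
    have [measurable]: "(\<lambda>x. \<integral>y. w x y \<partial>\<eta>) \<in> borel_measurable borel" "(\<lambda>y. \<integral>x. w x y \<partial>\<mu>) \<in> borel_measurable borel"
      unfolding w_def by measurable
    have "U x - (1 - \<delta>) * U x = \<delta> * U x" "V y - (1 - \<delta>) * V y = \<delta> * V y" for x y
      by (simp_all add: algebra_simps)
    then have "(\<integral>\<^sup>+x. ennreal (exp (\<integral>y. w x y \<partial>\<eta>) * exp (\<delta> * U x)) \<partial>\<mu>) < \<infinity>"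
      "(\<integral>\<^sup>+y. ennreal (exp (\<integral>x. w x y \<partial>\<mu>) * exp (\<delta> * V y)) \<partial>\<eta>) < \<infinity>"
      using lyap_nn nn_integral_gibbs_reweight[of "\<lambda>x. (1 - \<delta>) * U x" lam U "\<lambda>x. exp (\<integral>y. w x y \<partial>\<eta>)"]
        nn_integral_gibbs_reweight[of "\<lambda>y. (1 - \<delta>) * V y" nu V "\<lambda>y. exp (\<integral>x. w x y \<partial>\<mu>)"]
      by (simp_all add: \<mu>_def[symmetric] \<eta>_def[symmetric])
    then show "integrable \<mu> (\<lambda>x. exp (\<integral>y. w x y \<partial>\<eta>) * exp (\<delta> * U x))"
      "integrable \<eta> (\<lambda>y. exp (\<integral>x. w x y \<partial>\<mu>) * exp (\<delta> * V y))"
      by (auto intro!: integrableI_nonneg)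
  qed
  interpret lyapunov_cost \<mu> \<eta> w "\<lambda>x. exp (\<delta> * U x)" "\<lambda>y. exp (\<delta> * V y)" C
  proof
    show "\<exists>K. \<forall>x\<in>space \<mu>. exp (\<integral>y. w x y \<partial>\<eta>) \<le> \<epsilon> * exp (\<delta> * U x) + K" if "0 < \<epsilon>" for \<epsilon>
      using lyapunov_growth[of U \<delta> "\<lambda>x. \<integral>y. w x y \<partial>\<eta>" \<epsilon>] assms(16,22) H that by auto
    show "\<exists>K. \<forall>y\<in>space \<eta>. exp (\<integral>x. w x y \<partial>\<mu>) \<le> \<epsilon> * exp (\<delta> * V y) + K" if "0 < \<epsilon>" for \<epsilon>
      using lyapunov_growth[of V \<delta> "\<lambda>y. \<integral>x. w x y \<partial>\<mu>" \<epsilon>] assms(17,22) H that by auto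
    show "\<exists>\<omega>. \<forall>x\<in>space \<mu>. \<forall>y\<in>space \<eta>. exp (\<delta> * U x) \<le> R \<longrightarrow> exp (\<delta> * V y) \<le> R \<longrightarrow> w x y \<le> \<omega>" for R
      using bounded_on_exp_sublevels[OF assms(20,21,18,22), of R] by (auto simp: w_def)
    show "integrable \<eta> (\<lambda>y. w x y)" "integrable \<mu> (\<lambda>x. w x y)" for x y
      using H by (auto simp: w_def \<mu>_def \<eta>_def)
  qed (use AE_w lyap in \<open>auto simp: C_def\<close>)
  have pot_f_borel[measurable]: "pot_f n \<in> borel_measurable borel" and pot_g_borel[measurable]: "pot_g n \<in> borel_measurable borel" for n
    using pot_f_measurable[of n] pot_g_measurable[of n]
    by (simp_all add: measurable_cong_sets[OF sets_\<mu> refl] measurable_cong_sets[OF sets_\<eta> refl])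
  have Q: "kernel_Q nu W x = gibbs nu (w x)" and R: "kernel_R lam W y = gibbs lam (\<lambda>x. w x y)"
    and w_nu: "w x \<in> borel_measurable nu" and w_lam: "(\<lambda>x. w x y) \<in> borel_measurable lam" for x y
  proof -
    have "w x = (\<lambda>y. W (x, y))" "(\<lambda>x. w x y) = (\<lambda>x. W (x, y))" by (simp_all add: w_def fun_eq_iff)
    then show "kernel_Q nu W x = gibbs nu (w x)" "kernel_R lam W y = gibbs lam (\<lambda>x. w x y)"
      "w x \<in> borel_measurable nu" "(\<lambda>x. w x y) \<in> borel_measurable lam"
      by (simp_all add: kernel_Q_def kernel_R_def)
  qed
  have V_step: "sinkhorn_V lam nu U V W (Suc (2 * n)) = (\<lambda>y. V y + pot_g n y)"
    if "sinkhorn_U lam nu U V W (2 * n) = (\<lambda>x. U x + pot_f n x)" for n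
    using that gibbs_integral_exp[of "\<lambda>x. W (x, y)" lam U "pot_f n" for y]
    by (simp add: kernel_apply_def kernel_R_def pot_g.simps log_partition_def w_def \<mu>_def[symmetric])
  have U_eq: "sinkhorn_U lam nu U V W (2 * n) = (\<lambda>x. U x + pot_f n x)" for n
  proof (induction n)
    case (Suc n)
    have "kernel_apply (kernel_Q nu W) (\<lambda>y. exp (- (V y + pot_g n y))) x = (\<integral>y. exp (- w x y - pot_g n y) \<partial>\<eta>)" for x
      unfolding kernel_apply_def Q by (subst gibbs_integral_exp[OF w_nu, of V "pot_g n" x, folded \<eta>_def]) auto
    then show ?case using V_step[OF Suc] by (simp add: pot_f.simps(2) log_partition_def)
  qed simp
  have V_eq: "sinkhorn_V lam nu U V W (2 * Suc n) = (\<lambda>y. V y + pot_g n y)" for n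
    using V_step[OF U_eq[of n]] by simp
  \<comment> \<open>The densities of the transition kernels \<open>S\<^sub>2\<^sub>m\<^sub>+\<^sub>2\<close> and \<open>S\<^sub>2\<^sub>n\<^sub>+\<^sub>1\<close> with respect to the marginals.\<close>
  define ke where "ke m z = exp (- w (fst z) (snd z) - pot_g m (snd z)) / (\<integral>y. exp (- w (fst z) y - pot_g m y) \<partial>\<eta>)" for m z
  define ko where "ko n z = exp (- w (snd z) (fst z) - pot_f n (snd z)) / (\<integral>x. exp (- w x (fst z) - pot_f n x) \<partial>\<mu>)" for n z
  have [measurable]: "ke m \<in> borel_measurable (borel \<Otimes>\<^sub>M borel)" "ko m \<in> borel_measurable (borel \<Otimes>\<^sub>M borel)" for m
  proof -
    have W': "(\<lambda>(x, y). W (x, y)) \<in> borel_measurable (borel \<Otimes>\<^sub>M borel)" by simp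
    have w_borel[measurable]: "(\<lambda>(x, y). w x y) \<in> borel_measurable (borel \<Otimes>\<^sub>M borel)"
      using W' by (simp only: w_def)
    show "ke m \<in> borel_measurable (borel \<Otimes>\<^sub>M borel)" "ko m \<in> borel_measurable (borel \<Otimes>\<^sub>M borel)"
      unfolding ke_def ko_def by measurable
  qed
  have S_even: "sinkhorn_S_even lam nu U V W (Suc m) x = density \<eta> (\<lambda>y. ennreal (ke m (x, y)))" for m x
    unfolding sinkhorn_S_even_def V_eq ke_def prod.sel
    by (rule normalized_kernel_density[of "kernel_Q nu W" x nu "w x" V "pot_g m", OF Q w_nu, folded \<eta>_def]) measurable
  have S_odd: "sinkhorn_S_odd lam nu U V W n y = density \<mu> (\<lambda>x. ennreal (ko n (y, x)))" for n y
    unfolding sinkhorn_S_odd_def sinkhorn_U_odd U_eq ko_def prod.sel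
    by (rule normalized_kernel_density[of "kernel_R lam W" y lam "\<lambda>x. w x y" U "pot_f n", OF R w_lam, folded \<mu>_def]) measurable
  have sub_even: "subprob_space (sinkhorn_S_even lam nu U V W (Suc m) x)" for m x
    unfolding S_even ke_def prod.sel
    by (intro subprob_space_normalized_density \<eta>.prob_space_axioms) (use w_nu[of x] in \<open>auto simp: measurable_cong_sets[OF sets_nu refl]\<close>)
  have sub_odd: "subprob_space (sinkhorn_S_odd lam nu U V W n y)" for n y
    unfolding S_odd ko_def prod.sel
    by (intro subprob_space_normalized_density \<mu>.prob_space_axioms) (use w_lam[of y] in \<open>auto simp: measurable_cong_sets[OF sets_lam refl]\<close>)
  have ke_eq: "AE x in \<mu>. \<forall>y. ke m (x, y) = exp (- w x y - pot_f (Suc m) x - pot_g m y)" for m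
    using log_partition_bounds[OF pot_g_admissible[of m]]
  proof eventually_elim
    case (elim x)
    then have I: "(\<integral>y. exp (- w x y - pot_g m y) \<partial>\<eta>) = exp (pot_f (Suc m) x)" by (simp add: pot_f.simps(2))
    show ?case unfolding ke_def prod.sel I exp_diff[symmetric] by (simp add: algebra_simps)
  qed
  have ko_eq: "AE y in \<eta>. \<forall>x. ko n (y, x) = exp (- w x y - pot_f n x - pot_g n y)" for n
    using lyapunov_cost.log_partition_bounds[OF swap pot_f_admissible[of n]]
  proof eventually_elim
    case (elim y)
    then have I: "(\<integral>x. exp (- w x y - pot_f n x) \<partial>\<mu>) = exp (pot_g n y)" by (simp add: pot_g.simps)
    show ?case unfolding ko_def prod.sel I exp_diff[symmetric] by simp
  qed
  have P_even: "sinkhorn_P_even lam nu U V W (Suc m) = plan (pot_f (Suc m)) (pot_g m)" for m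
  proof -
    have "sinkhorn_P_even lam nu U V W (Suc m) = density (\<mu> \<Otimes>\<^sub>M \<eta>) (\<lambda>z. ennreal (ke m z))"
      unfolding sinkhorn_P_even_def \<mu>_def[symmetric]
      by (rule joint_density[OF \<mu>.prob_space_axioms \<eta>.prob_space_axioms sets_\<mu> sets_\<eta> _ S_even sub_even]) measurable
    also have "\<dots> = plan (pot_f (Suc m)) (pot_g m)"
      unfolding plan_def
    proof (rule density_cong)
      have "AE x in distr (\<mu> \<Otimes>\<^sub>M \<eta>) \<mu> fst. \<forall>y. ke m (x, y) = exp (- w x y - pot_f (Suc m) x - pot_g m y)"
        unfolding \<eta>.distr_pair_fst by (rule ke_eq)
      then have "AE z in \<mu> \<Otimes>\<^sub>M \<eta>. \<forall>y. ke m (fst z, y) = exp (- w (fst z) y - pot_f (Suc m) (fst z) - pot_g m y)"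
        by (rule AE_distrD[rotated]) measurable
      then show "AE z in \<mu> \<Otimes>\<^sub>M \<eta>. ennreal (ke m z) = (case z of (x, y) \<Rightarrow> ennreal (exp (- w x y - pot_f (Suc m) x - pot_g m y)))"
        by eventually_elim (auto simp: case_prod_beta')
    qed measurable
    finally show ?thesis .
  qed
  have pi_even: "sinkhorn_pi_even lam nu U V W (Suc m) = density \<eta> (\<lambda>y. ennreal (exp (pot_g (Suc m) y - pot_g m y)))" for m
  proof -
    have "sinkhorn_pi_even lam nu U V W (Suc m) = density \<eta> (\<lambda>y. \<integral>\<^sup>+x. ennreal (ke m (x, y)) \<partial>\<mu>)"
      unfolding sinkhorn_pi_even_def \<mu>_def[symmetric]
      by (rule bind_density_kernel[OF \<mu>.prob_space_axioms \<eta>.prob_space_axioms sets_\<mu> sets_\<eta> _ S_even sub_even]) measurable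
    also have "\<dots> = density \<eta> (\<lambda>y. ennreal (exp (pot_g (Suc m) y - pot_g m y)))"
    proof (rule density_cong)
      show "AE y in \<eta>. (\<integral>\<^sup>+x. ennreal (ke m (x, y)) \<partial>\<mu>) = ennreal (exp (pot_g (Suc m) y - pot_g m y))"
        using lyapunov_cost.kernel_mass[OF swap pot_f_admissible pot_g.simps, of "Suc m"]
      proof eventually_elim
        case (elim y)
        have e: "exp (- w x y - pot_f (Suc m) x - pot_g m y)
            = exp (pot_g (Suc m) y - pot_g m y) * exp (- w x y - pot_g (Suc m) y - pot_f (Suc m) x)" for x
          by (rule trans[OF arg_cong[of _ _ exp] exp_add]) simp
        have "(\<integral>\<^sup>+x. ennreal (ke m (x, y)) \<partial>\<mu>) = (\<integral>\<^sup>+x. ennreal (exp (- w x y - pot_f (Suc m) x - pot_g m y)) \<partial>\<mu>)"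
          using ke_eq[of m] by (intro nn_integral_cong_AE) (auto elim!: eventually_mono)
        also have "\<dots> = (\<integral>\<^sup>+x. ennreal (exp (pot_g (Suc m) y - pot_g m y)) * ennreal (exp (- w x y - pot_g (Suc m) y - pot_f (Suc m) x)) \<partial>\<mu>)"
          by (simp only: e ennreal_mult'[OF exp_ge_zero])
        also have "\<dots> = ennreal (exp (pot_g (Suc m) y - pot_g m y))"
          using elim by (subst nn_integral_cmult) (auto simp: w_def)
        finally show ?case .
      qed
    qed measurable
    finally show ?thesis .
  qed
  have pi_odd: "sinkhorn_pi_odd lam nu U V W n = density \<mu> (\<lambda>x. ennreal (exp (pot_f (Suc n) x - pot_f n x)))" for n
  proof -
    have "sinkhorn_pi_odd lam nu U V W n = density \<mu> (\<lambda>x. \<integral>\<^sup>+y. ennreal (ko n (y, x)) \<partial>\<eta>)"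
      unfolding sinkhorn_pi_odd_def \<eta>_def[symmetric]
      by (rule bind_density_kernel[OF \<eta>.prob_space_axioms \<mu>.prob_space_axioms sets_\<eta> sets_\<mu> _ S_odd sub_odd]) measurable
    also have "\<dots> = density \<mu> (\<lambda>x. ennreal (exp (pot_f (Suc n) x - pot_f n x)))"
    proof (rule density_cong)
      show "AE x in \<mu>. (\<integral>\<^sup>+y. ennreal (ko n (y, x)) \<partial>\<eta>) = ennreal (exp (pot_f (Suc n) x - pot_f n x))"
        using kernel_mass[OF pot_g_admissible pot_f.simps(2), of n]
      proof eventually_elim
        case (elim x)
        have e: "exp (- w x y - pot_f n x - pot_g n y)
            = exp (pot_f (Suc n) x - pot_f n x) * exp (- w x y - pot_f (Suc n) x - pot_g n y)" for y
          by (rule trans[OF arg_cong[of _ _ exp] exp_add]) simp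
        have "(\<integral>\<^sup>+y. ennreal (ko n (y, x)) \<partial>\<eta>) = (\<integral>\<^sup>+y. ennreal (exp (- w x y - pot_f n x - pot_g n y)) \<partial>\<eta>)"
          using ko_eq[of n] by (intro nn_integral_cong_AE) (auto elim!: eventually_mono)
        also have "\<dots> = (\<integral>\<^sup>+y. ennreal (exp (pot_f (Suc n) x - pot_f n x)) * ennreal (exp (- w x y - pot_f (Suc n) x - pot_g n y)) \<partial>\<eta>)"
          by (simp only: e ennreal_mult'[OF exp_ge_zero])
        also have "\<dots> = ennreal (exp (pot_f (Suc n) x - pot_f n x))"
          using elim by (subst nn_integral_cmult) (auto simp: w_def)
        finally show ?case .
      qed
    qed measurable
    finally show ?thesis .
  qed
  have P0: "P0 = plan (\<lambda>_. 0) (\<lambda>y. - V y)"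
  proof -
    have K: "kernel_Q nu W x = density \<eta> (\<lambda>y. ennreal (exp (- w x y - 0 - (- V y))))" for x
      unfolding kernel_Q_def \<eta>_def by (subst gibbs_reweight[of _ _ V]) (auto simp: w_def)
    have "subprob_space (kernel_Q nu W x)" for x
      using measurable_space[OF assms(12), of x] by (simp add: space_prob_algebra prob_space_imp_subprob_space)
    then have "joint \<mu> (kernel_Q nu W) = density (\<mu> \<Otimes>\<^sub>M \<eta>) (\<lambda>(x, y). ennreal (exp (- w x y - 0 - (- V y))))"
      by (intro joint_density[OF \<mu>.prob_space_axioms \<eta>.prob_space_axioms sets_\<mu> sets_\<eta>]) (auto simp: K w_def)
    then show ?thesis unfolding assms(13) \<mu>_def[symmetric] plan_def .
  qed
  \<comment> \<open>The minimisation defining the bridge is the one over the couplings of \<open>\<mu>\<close> and \<open>\<eta>\<close> in the abstract setting.\<close>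
  have coup: "(\<lambda>P. P \<in> couplings \<mu> \<eta>) = coupling"
  proof
    fix P
    have "distr P borel fst = distr P \<mu> fst" "distr P borel snd = distr P \<eta> snd"
      by (intro distr_cong sets_\<mu>[symmetric] sets_\<eta>[symmetric] refl)+
    moreover have "sets (\<mu> \<Otimes>\<^sub>M \<eta>) = sets (borel \<Otimes>\<^sub>M borel)" by (intro sets_pair_measure_cong sets_\<mu> sets_\<eta>)
    ultimately show "P \<in> couplings \<mu> \<eta> \<longleftrightarrow> coupling P" by (simp add: couplings_def coupling_def)
  qed
  have PP: "PP = arg_min (\<lambda>P. Ent P (plan (\<lambda>_. 0) (\<lambda>y. - V y))) coupling"
    using assms(15) by (simp add: schroedinger_bridge_def P0 \<mu>_def[symmetric] \<eta>_def[symmetric] coup)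
  \<comment> \<open>\<open>V\<close> is bounded below, and its positive part is at most \<open>exp (\<delta> * V) / \<delta>\<close>.\<close>
  have V_int: "integrable \<eta> (\<lambda>y. - V y)"
  proof -
    obtain v where v: "\<And>y. v \<le> V y" using compact_sublevels_bounded_below[OF assms(21,17)] by blast
    have "integrable \<eta> (\<lambda>y. - V y)"
    proof (rule Bochner_Integration.integrable_bound)
      show "integrable \<eta> (\<lambda>y. \<bar>v\<bar> + exp (\<delta> * V y) / \<delta>)" using \<psi>_int by simp
      show "AE y in \<eta>. norm (- V y) \<le> norm (\<bar>v\<bar> + exp (\<delta> * V y) / \<delta>)"
      proof (rule AE_I2)
        fix y
        have "\<delta> * V y \<le> exp (\<delta> * V y)" using exp_ge_add_one_self[of "\<delta> * V y"] by linarith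
        then have "V y \<le> exp (\<delta> * V y) / \<delta>" using assms(22) by (simp add: field_simps)
        moreover have "0 \<le> exp (\<delta> * V y) / \<delta>" using assms(22) by simp
        ultimately have "\<bar>V y\<bar> \<le> \<bar>v\<bar> + exp (\<delta> * V y) / \<delta>" using v[of y] by linarith
        then show "norm (- V y) \<le> norm (\<bar>v\<bar> + exp (\<delta> * V y) / \<delta>)" by simp
      qed
    qed simp
    then show ?thesis .
  qed
  define J where "J = (\<integral>x. \<phi> x \<partial>\<mu>) + (\<integral>y. \<psi> y \<partial>\<eta>)"
  \<comment> \<open>Since the Lyapunov functions are integrable, the right-hand side of the rate is positive, and it can be absorbed in the constant.\<close>
  have J: "0 < J"
  proof -
    have \<phi>e: "\<phi> = (\<lambda>x. exp (- \<delta> * (INF x. U x)) * exp (\<delta> * U x))"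
      and \<psi>e: "\<psi> = (\<lambda>y. exp (- \<delta> * (INF y. V y)) * exp (\<delta> * V y))"
      unfolding assms(25,26) by (auto simp: exp_add[symmetric] algebra_simps)
    have "(\<integral>x. exp (\<delta> * U x) \<partial>\<mu>) \<noteq> 0"
      using \<phi>_int by (subst integral_nonneg_eq_0_iff_AE) auto
    then have "0 < (\<integral>x. exp (\<delta> * U x) \<partial>\<mu>)" by (simp add: less_le)
    then have "0 < (\<integral>x. \<phi> x \<partial>\<mu>)" unfolding \<phi>e by simp
    moreover have "0 \<le> (\<integral>y. \<psi> y \<partial>\<eta>)" unfolding \<psi>e by simp
    ultimately show ?thesis by (simp add: J_def)
  qed
  obtain \<rho> c where series: "\<And>m. Ent PP (plan (pot_f (Suc m)) (pot_g m)) =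
       (\<Sum>p. Ent \<mu> (density \<mu> (\<lambda>x. ennreal (exp (pot_f (Suc (Suc m + p)) x - pot_f (Suc m + p) x))))) +
       (\<Sum>p. Ent \<eta> (density \<eta> (\<lambda>y. ennreal (exp (pot_g (Suc (m + p)) y - pot_g (m + p) y)))))"
    and \<rho>: "0 \<le> \<rho>" "\<rho> < 1" and c: "0 < c"
    and rate: "\<And>m. Ent PP (plan (pot_f (Suc m)) (pot_g m)) \<le> ereal (c * \<rho> ^ (2 * Suc m))"
    using sinkhorn_entropy[OF V_int PP] by blast
  show ?thesis
    unfolding \<mu>_def[symmetric] \<eta>_def[symmetric] J_def[symmetric]
  proof (intro conjI)
    show "\<forall>n\<ge>1. Ent PP (sinkhorn_P_even lam nu U V W n) =
       (\<Sum>p. Ent \<mu> (sinkhorn_pi_odd lam nu U V W (n + p))) + (\<Sum>p. Ent \<eta> (sinkhorn_pi_even lam nu U V W (n + p)))"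
    proof (intro allI impI)
      fix n :: nat assume "1 \<le> n"
      then obtain m where n: "n = Suc m" by (cases n) auto
      show "Ent PP (sinkhorn_P_even lam nu U V W n) =
       (\<Sum>p. Ent \<mu> (sinkhorn_pi_odd lam nu U V W (n + p))) + (\<Sum>p. Ent \<eta> (sinkhorn_pi_even lam nu U V W (n + p)))"
        using series[of m] by (simp add: n P_even pi_odd pi_even)
    qed
    have "\<forall>n\<ge>1. Ent PP (sinkhorn_P_even lam nu U V W n) \<le> ereal (c / J * \<rho> ^ (2 * n) * J)"
    proof (intro allI impI)
      fix n :: nat assume "1 \<le> n"
      then obtain m where n: "n = Suc m" by (cases n) auto
      show "Ent PP (sinkhorn_P_even lam nu U V W n) \<le> ereal (c / J * \<rho> ^ (2 * n) * J)"
        using rate[of m] J by (simp add: n P_even)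
    qed
    then show "\<exists>\<rho> c. 0 \<le> \<rho> \<and> \<rho> < 1 \<and> 0 < c \<and>
      (\<forall>n\<ge>1. Ent PP (sinkhorn_P_even lam nu U V W n) \<le> ereal (c * \<rho> ^ (2 * n) * J))"
      using \<rho> c J by - (rule exI[of _ \<rho>], rule exI[of _ "c / J"], simp)
  qed
qed

end
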